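(* There is a pushout square of algebraic theories: the square with top morphism $\mathrm{can}\colon\mathbb{Z}/2\text{-}\mathbf{Sets}\to\mathbf{Invo}$, left morphism $\mathrm{id}\colon\mathbb{Z}/2\text{-}\mathbf{Sets}\to\mathbf{Sets}$, right morphism ${\supset}\colon\mathbf{Invo}\to\mathbf{Kei}$, and bottom morphism the structure morphism $\mathbf{Sets}\to\mathbf{Kei}$ commutes and exhibits $\mathbf{Kei}$ as the pushout, in the category of algebraic theories, of \[ \mathbf{Sets}\xleftarrow{\ \mathrm{id}\ }\mathbb{Z}/2\text{-}\mathbf{Sets}\xrightarrow{\ \mathrm{can}\ }\mathbf{Invo}. \]
   Context: A rack $(R,\rhd)$ is a set $R$ with a binary operation $\rhd$ such that for every $x\in R$ the left multiplication $y\mapsto x\rhd y$ is bijective and $x\rhd(y\rhd z)=(x\rhd y)\rhd(x\rhd z)$ for all $y,z\in R$. Its canonical automorphism is $\mathrm{F}(x)=x\rhd x$. A quandle is a rack with $x\rhd x=x$ for all $x$. A rack is involutary if $x\rhd(x\rhd y)=y$ for all $x,y$. A kei is an involutary quandle. Morphisms are maps preserving $\rhd$. A $\mathbb{Z}/2$-set is a set with an action of the group $\mathbb{Z}/2$, i.e. a pair $(S,f)$ with $f\colon S\to S$ and $f^2=\mathrm{id}_S$; morphisms are equivariant maps. $\mathbf{Sets},\mathbb{Z}/2\text{-}\mathbf{Sets},\mathbf{Invo},\mathbf{Kei}$ denote both the algebraic (Lawvere) theories of sets, $\mathbb{Z}/2$-sets, involutary racks, kei and their categories of models. A morphism of algebraic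 theories $\mathbf{T}\to\mathbf{T}'$ is written in the direction of the left adjoint; it is the same as a ('forgetful', right-adjoint) functor from $\mathbf{T}'$-models to $\mathbf{T}$-models commuting with the underlying-set functors. The morphisms are given by their right adjoints: $\mathrm{can}$ by $(R,\rhd)\mapsto(R,\mathrm{F})$ (for an involutary rack, $\mathrm{F}^2=\mathrm{id}$); $\mathrm{id}$ by $S\mapsto(S,\mathrm{id}_S)$; $\supset$ by the inclusion of kei into involutary racks; the structure morphism $\mathbf{Sets}\to\mathbf{T}$ of a theory $\mathbf{T}$ by the underlying-set functor. *)

theory Defs
  imports "HOL-Library.FuncSet"
begin

section \<open>Algebraic theories\<close>

text \<open>
  A (one-sorted, finitary) algebraic theory in the sense of Lawvere: a category whose objects are
  the natural numbers, in which \<open>n\<close> is the \<open>n\<close>-fold power of \<open>1\<close> via chosen projections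
  \<open>Prj T n i : n \<rightarrow> 1\<close> for \<open>i < n\<close>.  An arrow \<open>m \<rightarrow> n\<close> is an \<open>n\<close>-tuple of \<open>m\<close>-ary operations.
  The composite of \<open>f : l \<rightarrow> m\<close> and \<open>g : m \<rightarrow> n\<close> is \<open>Cmp T l m n g f\<close>; it carries the
  objects as indices because the hom sets need not be disjoint.
\<close>

record 'a lawvere =
  Hom :: "nat \<Rightarrow> nat \<Rightarrow> 'a set"
  Idn :: "nat \<Rightarrow> 'a"
  Cmp :: "nat \<Rightarrow> nat \<Rightarrow> nat \<Rightarrow> 'a \<Rightarrow> 'a \<Rightarrow> 'a"
  Prj :: "nat \<Rightarrow> nat \<Rightarrow> 'a"

locale lawvere_theory =
  fixes T :: "'a lawvere"
  assumes idn_in: "Idn T n \<in> Hom T n n"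
    and cmp_in: "f \<in> Hom T l m \<Longrightarrow> g \<in> Hom T m n \<Longrightarrow> Cmp T l m n g f \<in> Hom T l n"
    and cmp_idn_right: "f \<in> Hom T m n \<Longrightarrow> Cmp T m m n f (Idn T m) = f"
    and cmp_idn_left: "f \<in> Hom T m n \<Longrightarrow> Cmp T m n n (Idn T n) f = f"
    and cmp_assoc: "f \<in> Hom T k l \<Longrightarrow> g \<in> Hom T l m \<Longrightarrow> h \<in> Hom T m n \<Longrightarrow>
      Cmp T k m n h (Cmp T k l m g f) = Cmp T k l n (Cmp T l m n h g) f"
    and prj_in: "i < n \<Longrightarrow> Prj T n i \<in> Hom T n 1"
    and prj_one: "Prj T 1 0 = Idn T 1"
    and power: "(\<And>i. i < n \<Longrightarrow> p i \<in> Hom T m 1) \<Longrightarrow>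
      \<exists>!f. f \<in> Hom T m n \<and> (\<forall>i<n. Cmp T m n 1 (Prj T n i) f = p i)"

text \<open>
  Morphisms of theories: identity-on-objects functors preserving the chosen projections.  The maps
  on hom sets are extensional, so that equality of morphisms is equality in HOL.
\<close>

definition theory_hom ::
    "('a, 'x) lawvere_scheme \<Rightarrow> ('b, 'y) lawvere_scheme \<Rightarrow> (nat \<Rightarrow> nat \<Rightarrow> 'a \<Rightarrow> 'b) set" where
  "theory_hom T T' = {\<phi>.
     (\<forall>m n. \<phi> m n \<in> Hom T m n \<rightarrow>\<^sub>E Hom T' m n) \<and>
     (\<forall>n. \<phi> n n (Idn T n) = Idn T' n) \<and>
     (\<forall>l m n. \<forall>f\<in>Hom T l m. \<forall>g\<in>Hom T m n.
        \<phi> l n (Cmp T l m n g f) = Cmp T' l m n (\<phi> m n g) (\<phi> l m f)) \<and>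
     (\<forall>n. \<forall>i<n. \<phi> n 1 (Prj T n i) = Prj T' n i)}"

text \<open>\<open>theory_comp T \<psi> \<phi>\<close> is the composite \<open>\<psi> \<circ> \<phi>\<close> of morphisms, where \<open>T\<close> is the domain of \<open>\<phi>\<close>.\<close>

definition theory_comp ::
    "('a, 'x) lawvere_scheme \<Rightarrow> (nat \<Rightarrow> nat \<Rightarrow> 'b \<Rightarrow> 'c) \<Rightarrow> (nat \<Rightarrow> nat \<Rightarrow> 'a \<Rightarrow> 'b) \<Rightarrow>
      (nat \<Rightarrow> nat \<Rightarrow> 'a \<Rightarrow> 'c)" where
  "theory_comp T \<psi> \<phi> = (\<lambda>m n. compose (Hom T m n) (\<psi> m n) (\<phi> m n))"

text \<open>
  The square
  \<open>
     S --upper--> B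
     |            |
    left         right
     v            v
     A --lower--> P
  \<close>
  commutes and is a pushout of algebraic theories.  HOL cannot quantify over types inside a definition, so the
  type of arrows of the test theories is a parameter, to be left as a type variable.
\<close>

definition is_pushout ::
    "'t itself \<Rightarrow> 's lawvere \<Rightarrow> 'a lawvere \<Rightarrow> 'b lawvere \<Rightarrow> 'p lawvere \<Rightarrow>
      (nat \<Rightarrow> nat \<Rightarrow> 's \<Rightarrow> 'b) \<Rightarrow> (nat \<Rightarrow> nat \<Rightarrow> 's \<Rightarrow> 'a) \<Rightarrow>
      (nat \<Rightarrow> nat \<Rightarrow> 'b \<Rightarrow> 'p) \<Rightarrow> (nat \<Rightarrow> nat \<Rightarrow> 'a \<Rightarrow> 'p) \<Rightarrow> bool" where
  "is_pushout _ S A B P upper left right lower \<longleftrightarrow>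
     lawvere_theory S \<and> lawvere_theory A \<and> lawvere_theory B \<and> lawvere_theory P \<and>
     upper \<in> theory_hom S B \<and> left \<in> theory_hom S A \<and>
     right \<in> theory_hom B P \<and> lower \<in> theory_hom A P \<and>
     theory_comp S right upper = theory_comp S lower left \<and>
     (\<forall>(T :: 't lawvere) f g.
        lawvere_theory T \<and> f \<in> theory_hom A T \<and> g \<in> theory_hom B T \<and>
        theory_comp S g upper = theory_comp S f left \<longrightarrow>
        (\<exists>!h. h \<in> theory_hom P T \<and>
              theory_comp A h lower = f \<and> theory_comp B h right = g))"


section \<open>The theory given by operations and equations\<close>

datatype 'f trm = Var nat | App 'f "'f trm list"

record 'f presentation =
  Ops :: "'f set"
  Ar :: "'f \<Rightarrow> nat"
  Eqs :: "('f trm \<times> 'f trm) set"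

primrec subst :: "(nat \<Rightarrow> 'f trm) \<Rightarrow> 'f trm \<Rightarrow> 'f trm" where
  "subst \<sigma> (Var i) = \<sigma> i"
| "subst \<sigma> (App f ts) = App f (map (subst \<sigma>) ts)"

text \<open>The terms in the variables \<open>Var 0, \<dots>, Var (m - 1)\<close>.\<close>

inductive_set trms :: "('f, 'x) presentation_scheme \<Rightarrow> nat \<Rightarrow> 'f trm set"
  for P :: "('f, 'x) presentation_scheme" and m :: nat where
  Var: "i < m \<Longrightarrow> Var i \<in> trms P m"
| App: "f \<in> Ops P \<Longrightarrow> length ts = Ar P f \<Longrightarrow> (\<forall>t\<in>set ts. t \<in> trms P m) \<Longrightarrow> App f ts \<in> trms P m"

text \<open>Equality of terms in \<open>m\<close> variables that is derivable from the equations.\<close>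

inductive eqv :: "('f, 'x) presentation_scheme \<Rightarrow> nat \<Rightarrow> 'f trm \<Rightarrow> 'f trm \<Rightarrow> bool"
  for P :: "('f, 'x) presentation_scheme" and m :: nat where
  Ax: "(l, r) \<in> Eqs P \<Longrightarrow> (\<And>i. \<sigma> i \<in> trms P m) \<Longrightarrow> eqv P m (subst \<sigma> l) (subst \<sigma> r)"
| Refl: "t \<in> trms P m \<Longrightarrow> eqv P m t t"
| Sym: "eqv P m s t \<Longrightarrow> eqv P m t s"
| Trans: "eqv P m s t \<Longrightarrow> eqv P m t u \<Longrightarrow> eqv P m s u"
| Cong: "f \<in> Ops P \<Longrightarrow> length ss = Ar P f \<Longrightarrow> list_all2 (eqv P m) ss ts \<Longrightarrow>
    eqv P m (App f ss) (App f ts)"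

definition cls :: "('f, 'x) presentation_scheme \<Rightarrow> nat \<Rightarrow> 'f trm \<Rightarrow> 'f trm set" where
  "cls P m t = {s. eqv P m t s}"

definition rep :: "'f trm set \<Rightarrow> 'f trm" where
  "rep c = (SOME t. t \<in> c)"

text \<open>
  An arrow \<open>m \<rightarrow> n\<close> is an \<open>n\<close>-tuple of elements of the free model on \<open>m\<close> generators, that is, a
  homomorphism from the free model on \<open>n\<close> to the free model on \<open>m\<close> generators.
\<close>

definition theory_of :: "('f, 'x) presentation_scheme \<Rightarrow> 'f trm set list lawvere" where
  "theory_of P =
    \<lparr> Hom = (\<lambda>m n. {map (cls P m) ts | ts. length ts = n \<and> set ts \<subseteq> trms P m}),
      Idn = (\<lambda>n. map (\<lambda>i. cls P n (Var i)) [0..<n]),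
      Cmp = (\<lambda>l m n g f. map (\<lambda>c. cls P l (subst (\<lambda>i. rep (f ! i)) (rep c))) g),
      Prj = (\<lambda>n i. [cls P n (Var i)]) \<rparr>"

text \<open>
  An assignment \<open>J\<close> of a term of \<open>Q\<close> in \<open>Ar P f\<close> variables to each operation \<open>f\<close> of \<open>P\<close> extends
  to all terms.
\<close>

primrec translate :: "('f \<Rightarrow> 'g trm) \<Rightarrow> 'f trm \<Rightarrow> 'g trm" where
  "translate J (Var i) = Var i"
| "translate J (App f ts) = subst (\<lambda>i. map (translate J) ts ! i) (J f)"

definition interp ::
    "('f, 'x) presentation_scheme \<Rightarrow> ('g, 'y) presentation_scheme \<Rightarrow> ('f \<Rightarrow> 'g trm) \<Rightarrow>
      (nat \<Rightarrow> nat \<Rightarrow> 'f trm set list \<Rightarrow> 'g trm set list)" where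
  "interp P Q J =
    (\<lambda>m n. \<lambda>cs\<in>Hom (theory_of P) m n. map (\<lambda>c. cls Q m (translate J (rep c))) cs)"

text \<open>The case in which every operation of \<open>P\<close> is also one of \<open>Q\<close>.\<close>

definition extend ::
    "('f, 'x) presentation_scheme \<Rightarrow> ('f, 'y) presentation_scheme \<Rightarrow>
      (nat \<Rightarrow> nat \<Rightarrow> 'f trm set list \<Rightarrow> 'f trm set list)" where
  "extend P Q = interp P Q (\<lambda>f. App f (map Var [0..<Ar P f]))"


section \<open>The theories of sets, \<open>\<int>/2\<close>-sets, involutary racks and kei\<close>

text \<open>\<open>Act\<close> is the action of the generator of \<open>\<int>/2\<close>, \<open>Tri\<close> is the rack operation.\<close>

datatype op_symbol = Act | Tri

primrec arity :: "op_symbol \<Rightarrow> nat" where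
  "arity Act = 1"
| "arity Tri = 2"

abbreviation tri :: "op_symbol trm \<Rightarrow> op_symbol trm \<Rightarrow> op_symbol trm" (infixr "\<triangleright>" 70) where
  "s \<triangleright> t \<equiv> App Tri [s, t]"

definition sets_pres :: "op_symbol presentation" where
  "sets_pres = \<lparr> Ops = {}, Ar = arity, Eqs = {} \<rparr>"

definition z2sets_pres :: "op_symbol presentation" where
  "z2sets_pres = \<lparr> Ops = {Act}, Ar = arity, Eqs = {(App Act [App Act [Var 0]], Var 0)} \<rparr>"

text \<open>Bijectivity of the left multiplications follows from the second equation.\<close>

definition invo_pres :: "op_symbol presentation" where
  "invo_pres = \<lparr> Ops = {Tri}, Ar = arity,
     Eqs = {(Var 0 \<triangleright> (Var 1 \<triangleright> Var 2), (Var 0 \<triangleright> Var 1) \<triangleright> (Var 0 \<triangleright> Var 2)),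
            (Var 0 \<triangleright> (Var 0 \<triangleright> Var 1), Var 1)} \<rparr>"

definition kei_pres :: "op_symbol presentation" where
  "kei_pres = \<lparr> Ops = {Tri}, Ar = arity,
     Eqs = insert (Var 0 \<triangleright> Var 0, Var 0) (Eqs invo_pres) \<rparr>"

type_synonym arr = "op_symbol trm set list"

definition Sets :: "arr lawvere" where "Sets = theory_of sets_pres"
definition Z2Sets :: "arr lawvere" where "Z2Sets = theory_of z2sets_pres"
definition Invo :: "arr lawvere" where "Invo = theory_of invo_pres"
definition Kei :: "arr lawvere" where "Kei = theory_of kei_pres"

text \<open>
  The four morphisms of the square, given on the operations; their right adjoints are computed in
  the last section.
\<close>

definition can :: "nat \<Rightarrow> nat \<Rightarrow> arr \<Rightarrow> arr" where
  "can = interp z2sets_pres invo_pres (\<lambda>_. Var 0 \<triangleright> Var 0)"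

definition ident :: "nat \<Rightarrow> nat \<Rightarrow> arr \<Rightarrow> arr" where
  "ident = interp z2sets_pres sets_pres (\<lambda>_. Var 0)"

definition invo_to_kei :: "nat \<Rightarrow> nat \<Rightarrow> arr \<Rightarrow> arr" where
  "invo_to_kei = extend invo_pres kei_pres"

definition sets_to_kei :: "nat \<Rightarrow> nat \<Rightarrow> arr \<Rightarrow> arr" where
  "sets_to_kei = extend sets_pres kei_pres"


section \<open>Models\<close>

definition tuples :: "'u set \<Rightarrow> nat \<Rightarrow> 'u list set" where
  "tuples A n = {xs. set xs \<subseteq> A \<and> length xs = n}"

text \<open>
  The full subcategory of the category of sets on the powers of \<open>A\<close>.  A model of \<open>T\<close> with
  underlying set \<open>A\<close> is a morphism of \<open>T\<close> into it, and the right adjoint of a morphism \<open>\<phi>\<close> of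
  theories is precomposition \<open>M \<mapsto> M \<circ> \<phi>\<close>.
\<close>

definition powers :: "'u set \<Rightarrow> ('u list \<Rightarrow> 'u list) lawvere" where
  "powers A =
    \<lparr> Hom = (\<lambda>m n. tuples A m \<rightarrow>\<^sub>E tuples A n),
      Idn = (\<lambda>n. \<lambda>xs\<in>tuples A n. xs),
      Cmp = (\<lambda>l m n g f. compose (tuples A l) g f),
      Prj = (\<lambda>n i. \<lambda>xs\<in>tuples A n. [xs ! i]) \<rparr>"

definition models :: "'a lawvere \<Rightarrow> 'u set \<Rightarrow> (nat \<Rightarrow> nat \<Rightarrow> 'a \<Rightarrow> 'u list \<Rightarrow> 'u list) set" where
  "models T A = theory_hom T (powers A)"

primrec eval :: "('f \<Rightarrow> 'u list \<Rightarrow> 'u) \<Rightarrow> (nat \<Rightarrow> 'u) \<Rightarrow> 'f trm \<Rightarrow> 'u" where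
  "eval I \<rho> (Var i) = \<rho> i"
| "eval I \<rho> (App f ts) = I f (map (eval I \<rho>) ts)"

definition algebra ::
    "('f, 'x) presentation_scheme \<Rightarrow> 'u set \<Rightarrow> ('f \<Rightarrow> 'u list \<Rightarrow> 'u) \<Rightarrow> bool" where
  "algebra P A I \<longleftrightarrow>
     (\<forall>f\<in>Ops P. I f \<in> tuples A (Ar P f) \<rightarrow> A) \<and>
     (\<forall>(l, r)\<in>Eqs P. \<forall>\<rho>. range \<rho> \<subseteq> A \<longrightarrow> eval I \<rho> l = eval I \<rho> r)"

definition alg_model ::
    "('f, 'x) presentation_scheme \<Rightarrow> 'u set \<Rightarrow> ('f \<Rightarrow> 'u list \<Rightarrow> 'u) \<Rightarrow>
      (nat \<Rightarrow> nat \<Rightarrow> 'f trm set list \<Rightarrow> 'u list \<Rightarrow> 'u list)" where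
  "alg_model P A I =
    (\<lambda>m n. \<lambda>cs\<in>Hom (theory_of P) m n. \<lambda>xs\<in>tuples A m. map (\<lambda>c. eval I ((!) xs) (rep c)) cs)"

definition wf_pres :: "('f, 'x) presentation_scheme \<Rightarrow> bool" where
  "wf_pres P \<longleftrightarrow> (\<forall>(l, r)\<in>Eqs P. \<exists>k>0. l \<in> trms P k \<and> r \<in> trms P k)"

lemma subst_trms: "t \<in> trms P m \<Longrightarrow> (\<And>i. i < m \<Longrightarrow> \<sigma> i \<in> trms P n) \<Longrightarrow> subst \<sigma> t \<in> trms P n"
  by (induction rule: trms.induct) (auto intro!: trms.App)

lemma subst_subst: "subst \<sigma> (subst \<tau> t) = subst (\<lambda>i. subst \<sigma> (\<tau> i)) t"
  by (induction t) auto

lemma subst_cong: "t \<in> trms P m \<Longrightarrow> (\<And>i. i < m \<Longrightarrow> \<sigma> i = \<tau> i) \<Longrightarrow> subst \<sigma> t = subst \<tau> t"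
  by (induction rule: trms.induct) auto

lemma subst_Var: "subst Var t = t"
  by (induction t) (auto simp: map_idI)

lemma eqv_trms:
  assumes "wf_pres P" "eqv P m s t"
  shows "s \<in> trms P m \<and> t \<in> trms P m"
  using assms(2)
proof induction
  case (Ax l r \<sigma>)
  then obtain k where "l \<in> trms P k" "r \<in> trms P k"
    using assms(1) unfolding wf_pres_def by blast
  with Ax show ?case by (blast intro: subst_trms)
next
  case (Cong f ss ts)
  then show ?case
    by (auto intro!: trms.intros simp: list_all2_conv_all_nth in_set_conv_nth)
qed auto

lemma eqv_subst:
  assumes "eqv P m s t" "\<And>i. i < m \<Longrightarrow> \<sigma> i \<in> trms P n" "wf_pres P"
  shows "eqv P n (subst \<sigma> s) (subst \<sigma> t)"
  using assms(1)
proof induction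
  case (Ax l r \<tau>)
  then show ?case
    unfolding subst_subst using assms(2) by (blast intro: eqv.Ax subst_trms)
next
  case (Refl t)
  then show ?case using assms(2) by (blast intro: eqv.Refl subst_trms)
next
  case (Cong f ss ts)
  then show ?case
    by (auto intro!: eqv.Cong simp: list_all2_conv_all_nth)
qed (blast intro: eqv.intros)+

lemma eqv_subst2:
  assumes "t \<in> trms P m" "\<And>i. i < m \<Longrightarrow> eqv P n (\<sigma> i) (\<tau> i)"
  shows "eqv P n (subst \<sigma> t) (subst \<tau> t)"
  using assms(1)
proof induction
  case (App f ts)
  then show ?case by (auto intro!: eqv.Cong simp: list_all2_conv_all_nth)
qed (use assms(2) in auto)

lemma cls_eq: "eqv P m s t \<Longrightarrow> cls P m s = cls P m t"
  unfolding cls_def by (blast intro: eqv.Sym eqv.Trans)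

lemma cls_eqD: "cls P m s = cls P m t \<Longrightarrow> t \<in> trms P m \<Longrightarrow> eqv P m s t"
  unfolding cls_def by (blast intro: eqv.Refl)

lemma rep_cls: "t \<in> trms P m \<Longrightarrow> eqv P m t (rep (cls P m t))"
  unfolding rep_def cls_def by (rule someI2) (auto intro: eqv.Refl)

lemma eval_subst: "eval I \<rho> (subst \<sigma> t) = eval I (\<lambda>i. eval I \<rho> (\<sigma> i)) t"
  by (induction t) (auto simp: o_def cong: map_cong)

lemma eval_cong:
  assumes "t \<in> trms P m" "\<And>i. i < m \<Longrightarrow> \<rho> i = \<rho>' i"
    and I: "\<And>f xs. f \<in> Ops P \<Longrightarrow> xs \<in> tuples A (Ar P f) \<Longrightarrow> I f xs = I' f xs \<and> I f xs \<in> A"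
    and "\<And>i. i < m \<Longrightarrow> \<rho> i \<in> A"
  shows "eval I \<rho> t = eval I' \<rho>' t \<and> eval I \<rho> t \<in> A"
  using assms(1)
proof induction
  case (App f ts)
  have eq: "map (eval I \<rho>) ts = map (eval I' \<rho>') ts" using App by auto
  have tup: "map (eval I \<rho>) ts \<in> tuples A (Ar P f)" using App unfolding tuples_def by auto
  show ?case
    unfolding eval.simps eq[symmetric] by (rule I[OF App(1) tup])
qed (use assms in auto)

lemma eval_in: "algebra P A I \<Longrightarrow> t \<in> trms P m \<Longrightarrow> (\<And>i. i < m \<Longrightarrow> \<rho> i \<in> A) \<Longrightarrow> eval I \<rho> t \<in> A"
  using eval_cong[of t P m \<rho> \<rho> A I I] unfolding algebra_def by blast

lemma eval_vars: "t \<in> trms P m \<Longrightarrow> (\<And>i. i < m \<Longrightarrow> \<rho> i = \<rho>' i) \<Longrightarrow> eval I \<rho> t = eval I \<rho>' t"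
  using eval_cong[of t P m \<rho> \<rho>' UNIV I I] by blast

lemma eval_eqv:
  assumes "algebra P A I" "eqv P m s t" "\<And>i. i < m \<Longrightarrow> \<rho> i \<in> A"
  shows "eval I \<rho> s = eval I \<rho> t"
  using assms(2)
proof induction
  case (Ax l r \<sigma>)
  have "range (\<lambda>i. eval I \<rho> (\<sigma> i)) \<subseteq> A" using Ax(2) assms by (auto intro: eval_in)
  then show ?case using assms(1) Ax(1) unfolding eval_subst algebra_def by blast
next
  case (Cong f ss ts)
  then have "map (eval I \<rho>) ss = map (eval I \<rho>) ts"
    by (auto intro!: nth_equalityI simp: list_all2_conv_all_nth)
  then show ?case by simp
qed auto

lemma theory_of_sel:
  "Hom (theory_of P) m n = {map (cls P m) ts | ts. length ts = n \<and> set ts \<subseteq> trms P m}"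
  "Idn (theory_of P) n = map (\<lambda>i. cls P n (Var i)) [0..<n]"
  "Cmp (theory_of P) l m n g f = map (\<lambda>c. cls P l (subst (\<lambda>i. rep (f ! i)) (rep c))) g"
  "Prj (theory_of P) n i = [cls P n (Var i)]"
  by (simp_all add: theory_of_def)

lemma in_Hom: "length ts = n \<Longrightarrow> set ts \<subseteq> trms P m \<Longrightarrow> map (cls P m) ts \<in> Hom (theory_of P) m n"
  unfolding theory_of_sel by blast

lemma Cmp_cls:
  assumes "wf_pres P" "length ts = m" "set ts \<subseteq> trms P l" "set ss \<subseteq> trms P m"
  shows "Cmp (theory_of P) l m n (map (cls P m) ss) (map (cls P l) ts)
    = map (\<lambda>s. cls P l (subst ((!) ts) s)) ss"
proof -
  have "cls P l (subst (\<lambda>i. rep (map (cls P l) ts ! i)) (rep (cls P m s)))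
      = cls P l (subst ((!) ts) s)" if s: "s \<in> set ss" for s
  proof -
    have 1: "eqv P m s (rep (cls P m s))" using s assms by (auto intro: rep_cls)
    then have 2: "rep (cls P m s) \<in> trms P m" using eqv_trms assms(1) by blast
    have ts: "ts ! i \<in> trms P l" if "i < m" for i using that assms by auto
    have "eqv P l (subst (\<lambda>i. rep (map (cls P l) ts ! i)) (rep (cls P m s)))
        (subst ((!) ts) (rep (cls P m s)))"
      using ts assms(2) by (intro eqv_subst2[OF 2]) (auto intro: eqv.Sym rep_cls)
    moreover have "eqv P l (subst ((!) ts) s) (subst ((!) ts) (rep (cls P m s)))"
      by (rule eqv_subst[OF 1 _ assms(1)]) (use ts in auto)
    ultimately show ?thesis by (metis cls_eq)
  qed
  then show ?thesis by (simp add: theory_of_sel o_def)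
qed

lemma powers_sel:
  "Hom (powers A) m n = (tuples A m \<rightarrow>\<^sub>E tuples A n)"
  "Idn (powers A) n = (\<lambda>xs\<in>tuples A n. xs)"
  "Cmp (powers A) l m n g f = compose (tuples A l) g f"
  "Prj (powers A) n i = (\<lambda>xs\<in>tuples A n. [xs ! i])"
  by (simp_all add: powers_def)

lemma alg_model_cls:
  assumes "algebra P A I" "set ts \<subseteq> trms P m" "xs \<in> tuples A m" "length ts = n"
  shows "alg_model P A I m n (map (cls P m) ts) xs = map (eval I ((!) xs)) ts"
proof -
  have "eval I ((!) xs) (rep (cls P m t)) = eval I ((!) xs) t" if "t \<in> set ts" for t
    by (rule eval_eqv[OF assms(1), symmetric, of m])
       (use that assms in \<open>auto intro: rep_cls simp: tuples_def\<close>)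
  then show ?thesis using assms in_Hom[of ts n P m] unfolding alg_model_def by auto
qed

lemma alg_model_in_models:
  assumes P: "wf_pres P" and I: "algebra P A I"
  shows "alg_model P A I \<in> models (theory_of P) A"
proof -
  have tup: "map (eval I ((!) xs)) ts \<in> tuples A n"
    if "set ts \<subseteq> trms P m" "xs \<in> tuples A m" "length ts = n" for xs ts m n
    using that eval_in[OF I, of _ m "(!) xs"] unfolding tuples_def by (auto simp: subset_iff)
  have 1: "alg_model P A I m n \<in> Hom (theory_of P) m n \<rightarrow>\<^sub>E (tuples A m \<rightarrow>\<^sub>E tuples A n)" for m n
  proof (intro PiE_I)
    fix cs xs assume cs: "cs \<in> Hom (theory_of P) m n" and xs: "xs \<in> tuples A m"
    then obtain ts where "cs = map (cls P m) ts" "length ts = n" "set ts \<subseteq> trms P m"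
      unfolding theory_of_sel by blast
    then show "alg_model P A I m n cs xs \<in> tuples A n"
      using alg_model_cls[OF I] tup xs by metis
  qed (auto simp: alg_model_def)
  have ext: "alg_model P A I m n cs \<in> extensional (tuples A m)"
    if "cs \<in> Hom (theory_of P) m n" for cs m n
    using that by (simp add: alg_model_def)
  have vars: "set (map Var [0..<n]) \<subseteq> trms P n" for n by (auto intro: trms.Var)
  have 2: "alg_model P A I n n (Idn (theory_of P) n) = Idn (powers A) n" for n
  proof (rule extensionalityI[of _ "tuples A n"])
    have "Idn (theory_of P) n = map (cls P n) (map Var [0..<n])" by (simp add: theory_of_sel)
    then show "alg_model P A I n n (Idn (theory_of P) n) xs = Idn (powers A) n xs"
      if "xs \<in> tuples A n" for xs
      using alg_model_cls[OF I vars that, of n] that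
      by (simp add: powers_sel o_def) (auto simp: tuples_def map_nth)
    show "alg_model P A I n n (Idn (theory_of P) n) \<in> extensional (tuples A n)"
      using ext[OF in_Hom[OF _ vars]] by (simp add: theory_of_sel o_def)
  qed (simp add: powers_sel)
  have 3: "alg_model P A I n 1 (Prj (theory_of P) n i) = Prj (powers A) n i" if i: "i < n" for n i
  proof (rule extensionalityI[of _ "tuples A n"])
    have v: "set [Var i] \<subseteq> trms P n" using i by (auto intro: trms.Var)
    have e: "Prj (theory_of P) n i = map (cls P n) [Var i]" by (simp add: theory_of_sel)
    show "alg_model P A I n 1 (Prj (theory_of P) n i) xs = Prj (powers A) n i xs"
      if "xs \<in> tuples A n" for xs
      unfolding e using alg_model_cls[OF I v that, of 1] that by (simp add: powers_sel)
    show "alg_model P A I n 1 (Prj (theory_of P) n i) \<in> extensional (tuples A n)"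
      unfolding e by (rule ext[OF in_Hom[OF _ v]]) simp
  qed (simp add: powers_sel)
  have 4: "alg_model P A I l n (Cmp (theory_of P) l m n g f)
      = Cmp (powers A) l m n (alg_model P A I m n g) (alg_model P A I l m f)"
    if f: "f \<in> Hom (theory_of P) l m" and g: "g \<in> Hom (theory_of P) m n" for l m n f g
  proof -
    obtain ts where ts: "f = map (cls P l) ts" "length ts = m" "set ts \<subseteq> trms P l"
      using f unfolding theory_of_sel by blast
    obtain ss where ss: "g = map (cls P m) ss" "length ss = n" "set ss \<subseteq> trms P m"
      using g unfolding theory_of_sel by blast
    let ?us = "map (subst ((!) ts)) ss"
    have c: "Cmp (theory_of P) l m n g f = map (cls P l) ?us"
      unfolding ts ss using Cmp_cls[OF P ts(2,3) ss(3)] by (simp add: o_def)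
    have us: "set ?us \<subseteq> trms P l" using ts ss by (auto intro!: subst_trms)
    have "eval I ((!) xs) (subst ((!) ts) s) = eval I ((!) (map (eval I ((!) xs)) ts)) s"
      if "s \<in> set ss" for s xs
      unfolding eval_subst by (rule eval_vars[of _ P m]) (use that ts ss in auto)
    then have e: "map (eval I ((!) xs)) ?us = map (eval I ((!) (map (eval I ((!) xs)) ts))) ss" for xs
      by simp
    show ?thesis
    proof (rule extensionalityI[of _ "tuples A l"])
      show "alg_model P A I l n (Cmp (theory_of P) l m n g f) \<in> extensional (tuples A l)"
        unfolding c by (rule ext[OF in_Hom[OF _ us]]) (use ss in simp)
      show "alg_model P A I l n (Cmp (theory_of P) l m n g f) xs
        = Cmp (powers A) l m n (alg_model P A I m n g) (alg_model P A I l m f) xs"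
        if xs: "xs \<in> tuples A l" for xs
        unfolding c powers_sel compose_def using xs e
        by (simp add: alg_model_cls[OF I us xs] ts(1) ss(1) ss(2)
            alg_model_cls[OF I ts(3) xs ts(2)] alg_model_cls[OF I ss(3) tup[OF ts(3) xs ts(2)] ss(2)]
            del: map_map)
    qed (simp add: powers_sel)
  qed
  show ?thesis
    unfolding models_def theory_hom_def using 1 2 3 4 by (simp add: powers_sel(1))
qed

lemma theory_hom_PiE: "\<phi> \<in> theory_hom T T' \<Longrightarrow> \<phi> m n \<in> Hom T m n \<rightarrow>\<^sub>E Hom T' m n"
  unfolding theory_hom_def by simp

lemma models_PiE: "M \<in> models T A \<Longrightarrow> M m n \<in> Hom T m n \<rightarrow>\<^sub>E (tuples A m \<rightarrow>\<^sub>E tuples A n)"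
  unfolding models_def theory_hom_def powers_sel by blast

lemma model_value:
  assumes P: "wf_pres P" and M: "M \<in> models (theory_of P) A"
    and ts: "length ts = n" "set ts \<subseteq> trms P m" and xs: "xs \<in> tuples A m"
  shows "M m n (map (cls P m) ts) xs \<in> tuples A n"
    and "i < n \<Longrightarrow> M m 1 [cls P m (ts ! i)] xs = [M m n (map (cls P m) ts) xs ! i]"
proof -
  let ?c = "map (cls P m) ts"
  have c: "?c \<in> Hom (theory_of P) m n" by (rule in_Hom) (use ts in auto)
  show 1: "M m n ?c xs \<in> tuples A n" using models_PiE[OF M, of m n] c xs by blast
  assume i: "i < n"
  have v: "[cls P n (Var i)] \<in> Hom (theory_of P) n 1"
    using in_Hom[of "[Var i]" 1 P n] i by (auto intro: trms.Var)
  have "[cls P m (ts ! i)] = Cmp (theory_of P) m n 1 (map (cls P n) [Var i]) ?c"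
    by (subst Cmp_cls) (use P ts i in \<open>auto intro: trms.Var\<close>)
  then have "M m 1 [cls P m (ts ! i)] = Cmp (powers A) m n 1 (M n 1 [cls P n (Var i)]) (M m n ?c)"
    using M c v unfolding models_def theory_hom_def by auto
  moreover have "M n 1 [cls P n (Var i)] = Prj (powers A) n i"
    using M i unfolding models_def theory_hom_def theory_of_sel(4) by auto
  ultimately show "M m 1 [cls P m (ts ! i)] xs = [M m n ?c xs ! i]"
    using xs 1 by (simp add: powers_sel compose_def)
qed

lemma model_is_alg_model:
  assumes P: "wf_pres P" and M: "M \<in> models (theory_of P) A"
  shows "\<exists>I. algebra P A I \<and> M = alg_model P A I"
proof -
  define I where
    "I = (\<lambda>f xs. hd (M (Ar P f) 1 [cls P (Ar P f) (App f (map Var [0..<Ar P f]))] xs))"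
  have tt: "App f (map Var [0..<Ar P f]) \<in> trms P (Ar P f)" if "f \<in> Ops P" for f
    using that by (auto intro!: trms.intros)
  have I1: "M (Ar P f) 1 [cls P (Ar P f) (App f (map Var [0..<Ar P f]))] xs = [I f xs] \<and> I f xs \<in> A"
    if f: "f \<in> Ops P" and xs: "xs \<in> tuples A (Ar P f)" for f xs
    using model_value(1)[OF P M _ _ xs, of "[App f (map Var [0..<Ar P f])]" 1] tt[OF f]
    unfolding I_def tuples_def by (auto simp: length_Suc_conv)
  have ev: "M m 1 [cls P m t] xs = [eval I ((!) xs) t]" if "t \<in> trms P m" "xs \<in> tuples A m" for m t xs
    using that(1)
  proof induction
    case (Var i)
    have "M m 1 (Prj (theory_of P) m i) = Prj (powers A) m i"
      using M Var unfolding models_def theory_hom_def by auto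
    then show ?case using that(2) by (simp add: theory_of_sel powers_sel)
  next
    case (App f ts)
    let ?k = "Ar P f" and ?c = "map (cls P m) ts"
    have ts: "set ts \<subseteq> trms P m" using App by auto
    have c: "?c \<in> Hom (theory_of P) m ?k" by (rule in_Hom) (use App ts in auto)
    let ?op = "App f (map Var [0..<?k])"
    have o: "[cls P ?k ?op] \<in> Hom (theory_of P) ?k 1"
      using in_Hom[of "[?op]" 1 P ?k] tt App by auto
    have "subst ((!) ts) ?op = App f ts" using App by (auto intro: nth_equalityI)
    then have "[cls P m (App f ts)] = Cmp (theory_of P) m ?k 1 (map (cls P ?k) [?op]) ?c"
      by (subst Cmp_cls) (use P App ts tt in auto)
    then have "M m 1 [cls P m (App f ts)] = Cmp (powers A) m ?k 1 (M ?k 1 [cls P ?k ?op]) (M m ?k ?c)"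
      using M c o unfolding models_def theory_hom_def by auto
    then have e: "M m 1 [cls P m (App f ts)] xs = M ?k 1 [cls P ?k ?op] (M m ?k ?c xs)"
      using that(2) by (simp add: powers_sel compose_def)
    have y: "M m ?k ?c xs \<in> tuples A ?k"
      using model_value(1)[OF P M _ ts that(2)] App by auto
    have "M m ?k ?c xs = map (eval I ((!) xs)) ts"
    proof (rule nth_equalityI)
      show l: "length (M m ?k ?c xs) = length (map (eval I ((!) xs)) ts)"
        using y App unfolding tuples_def by auto
      fix i assume "i < length (M m ?k ?c xs)"
      then have i: "i < ?k" "i < length ts" using l App by auto
      then have "M m 1 [cls P m (ts ! i)] xs = [eval I ((!) xs) (ts ! i)]" using App by auto
      with model_value(2)[OF P M _ ts that(2) i(1)] App i
      show "M m ?k ?c xs ! i = map (eval I ((!) xs)) ts ! i" by auto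
    qed
    then show ?case using e I1[OF App(1) y] by simp
  qed
  have alg: "algebra P A I"
    unfolding algebra_def
  proof (intro conjI ballI, goal_cases)
    case (1 f) then show ?case using I1 by blast
  next
    case (2 p)
    obtain l r where p: "p = (l, r)" by force
    with 2 P obtain k where k: "k > 0" "l \<in> trms P k" "r \<in> trms P k" unfolding wf_pres_def by blast
    have "eval I \<rho> l = eval I \<rho> r" if \<rho>: "range \<rho> \<subseteq> A" for \<rho>
    proof -
      let ?xs = "map \<rho> [0..<k]" and ?\<sigma> = "\<lambda>i. Var (if i < k then i else 0)"
      have xs: "?xs \<in> tuples A k" using \<rho> unfolding tuples_def by auto
      have "eqv P k (subst ?\<sigma> l) (subst ?\<sigma> r)"
        by (rule eqv.Ax) (use 2 p k in \<open>auto intro!: trms.Var\<close>)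
      moreover have \<sigma>: "subst ?\<sigma> t = t" if "t \<in> trms P k" for t
        by (rule trans[OF subst_cong[OF that, where \<tau> = Var] subst_Var]) simp
      ultimately have "cls P k l = cls P k r"
        unfolding \<sigma>[OF k(2)] \<sigma>[OF k(3)] by (intro cls_eq)
      then have "eval I ((!) ?xs) l = eval I ((!) ?xs) r"
        using ev[OF k(2) xs] ev[OF k(3) xs] by simp
      moreover have "eval I ((!) ?xs) t = eval I \<rho> t" if "t \<in> trms P k" for t
        by (rule eval_vars[OF that]) auto
      ultimately show ?thesis using k by simp
    qed
    then show ?case using p by simp
  qed
  moreover have "M = alg_model P A I"
  proof (intro ext)
    fix m n cs xs
    show "M m n cs xs = alg_model P A I m n cs xs"
    proof (cases "cs \<in> Hom (theory_of P) m n \<and> xs \<in> tuples A m")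
      case True
      then obtain ts where ts: "cs = map (cls P m) ts" "length ts = n" "set ts \<subseteq> trms P m"
        unfolding theory_of_sel by blast
      have xs: "xs \<in> tuples A m" using True by blast
      have "M m n cs xs = map (eval I ((!) xs)) ts"
      proof (rule nth_equalityI)
        show l: "length (M m n cs xs) = length (map (eval I ((!) xs)) ts)"
          using model_value(1)[OF P M ts(2,3) xs] ts unfolding tuples_def by auto
        fix i assume "i < length (M m n cs xs)"
        then have i: "i < n" using l ts by simp
        then have "ts ! i \<in> trms P m" using ts by auto
        from ev[OF this xs] model_value(2)[OF P M ts(2,3) xs i] i ts
        show "M m n cs xs ! i = map (eval I ((!) xs)) ts ! i" by simp
      qed
      then show ?thesis using alg_model_cls[OF alg ts(3) xs ts(2)] ts(1) by simp
    next
      case False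
      have u: "M' m n cs xs = (if cs \<in> Hom (theory_of P) m n then undefined else undefined xs)"
        if "M' \<in> models (theory_of P) A" for M'
        using models_PiE[OF that, of m n] False
        by (auto simp: PiE_def Pi_def extensional_def)
      show ?thesis using u[OF M] u[OF alg_model_in_models[OF P alg]] by simp
    qed
  qed
  ultimately show ?thesis by blast
qed

lemma translate_trms:
  assumes "\<And>f. f \<in> Ops P \<Longrightarrow> J f \<in> trms Q (Ar P f)" "t \<in> trms P m"
  shows "translate J t \<in> trms Q m"
  using assms(2)
proof induction
  case (App f ts)
  then show ?case by (auto intro!: subst_trms[OF assms(1)])
qed (auto intro: trms.Var)

lemma eval_translate:
  assumes "\<And>f. f \<in> Ops P \<Longrightarrow> J f \<in> trms Q (Ar P f)" "t \<in> trms P m"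
  shows "eval I \<rho> (translate J t) = eval (\<lambda>f xs. eval I ((!) xs) (J f)) \<rho> t"
  using assms(2)
proof induction
  case (App f ts)
  have "eval I (\<lambda>i. eval I \<rho> (map (translate J) ts ! i)) (J f)
      = eval I ((!) (map (eval (\<lambda>f xs. eval I ((!) xs) (J f)) \<rho>) ts)) (J f)"
    by (rule eval_vars[OF assms(1)]) (use App in auto)
  then show ?case by (simp add: eval_subst)
qed auto

lemma right_adjoint_interp:
  assumes P: "wf_pres P" and J: "\<And>f. f \<in> Ops P \<Longrightarrow> J f \<in> trms Q (Ar P f)"
    and I: "algebra Q A I"
    and I': "\<And>f xs. f \<in> Ops P \<Longrightarrow> xs \<in> tuples A (Ar P f) \<Longrightarrow> I' f xs = eval I ((!) xs) (J f)"
  shows "theory_comp (theory_of P) (alg_model Q A I) (interp P Q J) = alg_model P A I'"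
proof (intro ext)
  fix m n cs xs
  show "theory_comp (theory_of P) (alg_model Q A I) (interp P Q J) m n cs xs
    = alg_model P A I' m n cs xs"
  proof (cases "cs \<in> Hom (theory_of P) m n")
    case True
    then obtain ts where ts: "cs = map (cls P m) ts" "length ts = n" "set ts \<subseteq> trms P m"
      unfolding theory_of_sel by blast
    have r: "rep c \<in> trms P m" if "c \<in> set cs" for c
      using that ts eqv_trms[OF P rep_cls] by auto
    let ?us = "map (\<lambda>c. translate J (rep c)) cs"
    have us: "set ?us \<subseteq> trms Q m" using r translate_trms[of P J Q, OF J] by auto
    have i: "interp P Q J m n cs = map (cls Q m) ?us" unfolding interp_def using True by simp
    have l: "length ?us = n" using ts by simp
    show ?thesis
    proof (cases "xs \<in> tuples A m")
      case xs: True
      have "eval I ((!) xs) (translate J (rep c)) = eval I' ((!) xs) (rep c)" if "c \<in> set cs" for c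
      proof -
        have e: "eval I ((!) xs) (J f) \<in> A" if "f \<in> Ops P" "xs \<in> tuples A (Ar P f)" for f xs
          by (rule eval_in[OF I J]) (use that in \<open>auto simp: tuples_def\<close>)
        have "eval I ((!) xs) (translate J (rep c))
            = eval (\<lambda>f xs. eval I ((!) xs) (J f)) ((!) xs) (rep c)"
          by (rule eval_translate[OF _ r[OF that], of J Q]) (rule J)
        also have "\<dots> = eval I' ((!) xs) (rep c)"
          by (rule eval_cong[where A = A, OF r[OF that], THEN conjunct1])
             (use xs e I' in \<open>auto simp: tuples_def\<close>)
        finally show ?thesis .
      qed
      then show ?thesis
        using alg_model_cls[OF I us xs l] i True xs
        by (simp add: theory_comp_def compose_def alg_model_def[of P] o_def)
    next
      case False
      then show ?thesis
        using True in_Hom[OF l us] i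
        by (simp add: theory_comp_def compose_def alg_model_def del: map_map)
    qed
  qed (simp add: theory_comp_def compose_def alg_model_def)
qed

text \<open>
  A morphism of theories is determined by its right adjoint, already on the models whose carrier
  consists of elements of the type in which the free models live.
\<close>

lemma right_adjoint_unique:
  fixes Q :: "('g, 'y) presentation_scheme"
  assumes Q: "wf_pres Q"
    and \<phi>: "\<phi> \<in> theory_hom T (theory_of Q)" and \<psi>: "\<psi> \<in> theory_hom T (theory_of Q)"
    and eq: "\<And>(A :: 'g trm set set) M. M \<in> models (theory_of Q) A \<Longrightarrow>
               theory_comp T M \<phi> = theory_comp T M \<psi>"
  shows "\<phi> = \<psi>"
proof (intro ext)
  fix m n a
  show "\<phi> m n a = \<psi> m n a"
  proof (cases "a \<in> Hom T m n")
    case False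
    have u: "\<chi> m n a = undefined" if "\<chi> \<in> theory_hom T (theory_of Q)" for \<chi>
    proof -
      have "\<chi> m n \<in> Hom T m n \<rightarrow>\<^sub>E Hom (theory_of Q) m n"
        by (rule theory_hom_PiE[OF that])
      with False show ?thesis by (auto simp: PiE_def extensional_def)
    qed
    show ?thesis using u[OF \<phi>] u[OF \<psi>] by simp
  next
    case True
    define A where "A = cls Q m ` trms Q m"
    define I where "I = (\<lambda>f cs. cls Q m (App f (map rep cs)))"
    have rc: "rep c \<in> trms Q m \<and> cls Q m (rep c) = c" if c: "c \<in> A" for c
    proof -
      obtain t where t: "t \<in> trms Q m" "c = cls Q m t" using c unfolding A_def by blast
      with rep_cls[OF t(1)] eqv_trms[OF Q] cls_eq show ?thesis by metis
    qed
    have ev: "eval I \<rho> t = cls Q m (subst (\<lambda>i. rep (\<rho> i)) t)"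
      if "t \<in> trms Q k" "\<And>i. i < k \<Longrightarrow> \<rho> i \<in> A" for t k \<rho>
      using that(1)
    proof induction
      case (Var i)
      then show ?case using that rc by simp
    next
      case (App f ts)
      let ?us = "map (subst (\<lambda>i. rep (\<rho> i))) ts"
      have us: "u \<in> trms Q m" if "u \<in> set ?us" for u
        using that App rc \<open>\<And>i. i < k \<Longrightarrow> \<rho> i \<in> A\<close> by (auto intro!: subst_trms)
      have "map (eval I \<rho>) ts = map (cls Q m) ?us" using App by auto
      moreover have "eqv Q m (App f (map rep (map (cls Q m) ?us))) (App f ?us)"
        by (rule eqv.Cong)
           (use App us in \<open>auto simp: list_all2_conv_all_nth intro!: eqv.Sym[OF rep_cls]\<close>)
      ultimately show ?case by (simp add: I_def cls_eq del: map_map)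
    qed
    have alg: "algebra Q A I"
      unfolding algebra_def
    proof (intro conjI ballI, goal_cases)
      case (1 f)
      show ?case
      proof
        fix cs assume "cs \<in> tuples A (Ar Q f)"
        then have "App f (map rep cs) \<in> trms Q m"
          using 1 rc by (auto intro!: trms.App simp: tuples_def subset_iff)
        then show "I f cs \<in> A" by (simp add: I_def A_def)
      qed
    next
      case (2 p)
      obtain l r where p: "p = (l, r)" by force
      with 2 Q obtain k where k: "l \<in> trms Q k" "r \<in> trms Q k" unfolding wf_pres_def by blast
      have "eval I \<rho> l = eval I \<rho> r" if "range \<rho> \<subseteq> A" for \<rho>
      proof -
        have \<rho>: "\<rho> i \<in> A" for i using that by auto
        have "eqv Q m (subst (\<lambda>i. rep (\<rho> i)) l) (subst (\<lambda>i. rep (\<rho> i)) r)"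
          by (rule eqv.Ax) (use 2 p rc \<rho> in auto)
        then show ?thesis using ev[OF k(1) \<rho>] ev[OF k(2) \<rho>] by (simp add: cls_eq)
      qed
      then show ?case using p by simp
    qed
    define gen where "gen = map (\<lambda>i. cls Q m (Var i)) [0..<m]"
    have gen: "gen \<in> tuples A m"
      unfolding gen_def tuples_def A_def by (auto intro!: imageI trms.Var)
    have value_gen: "alg_model Q A I m n cs gen = cs" if cs: "cs \<in> Hom (theory_of Q) m n" for cs
    proof -
      obtain ts where ts: "cs = map (cls Q m) ts" "length ts = n" "set ts \<subseteq> trms Q m"
        using cs unfolding theory_of_sel by blast
      have "eval I ((!) gen) t = cls Q m t" if t: "t \<in> set ts" for t
      proof -
        have "eqv Q m (subst (\<lambda>i. rep (gen ! i)) t) (subst Var t)"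
          by (rule eqv_subst2[of _ _ m])
             (use ts t in \<open>auto simp: gen_def intro!: eqv.Sym[OF rep_cls] trms.Var\<close>)
        moreover have "eval I ((!) gen) t = cls Q m (subst (\<lambda>i. rep (gen ! i)) t)"
          by (rule ev[of _ m]) (use ts t gen in \<open>auto simp: tuples_def\<close>)
        ultimately show ?thesis by (simp add: cls_eq subst_Var)
      qed
      then show ?thesis using alg_model_cls[OF alg ts(3) gen ts(2)] ts(1) by simp
    qed
    have "theory_comp T (alg_model Q A I) \<phi> m n a gen = theory_comp T (alg_model Q A I) \<psi> m n a gen"
      using eq[OF alg_model_in_models[OF Q alg]] by simp
    moreover have "\<phi> m n a \<in> Hom (theory_of Q) m n" "\<psi> m n a \<in> Hom (theory_of Q) m n"
      using PiE_mem[OF theory_hom_PiE[OF \<phi>] True] PiE_mem[OF theory_hom_PiE[OF \<psi>] True] .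
    ultimately show ?thesis using True value_gen by (simp add: theory_comp_def compose_def)
  qed
qed


section \<open>Racks, kei, and the right adjoints\<close>

definition rack :: "'u set \<Rightarrow> ('u \<Rightarrow> 'u \<Rightarrow> 'u) \<Rightarrow> bool" where
  "rack R op \<longleftrightarrow>
     (\<forall>x\<in>R. bij_betw (op x) R R) \<and>
     (\<forall>x\<in>R. \<forall>y\<in>R. \<forall>z\<in>R. op x (op y z) = op (op x y) (op x z))"

definition quandle :: "'u set \<Rightarrow> ('u \<Rightarrow> 'u \<Rightarrow> 'u) \<Rightarrow> bool" where
  "quandle R op \<longleftrightarrow> rack R op \<and> (\<forall>x\<in>R. op x x = x)"

definition involutary_rack :: "'u set \<Rightarrow> ('u \<Rightarrow> 'u \<Rightarrow> 'u) \<Rightarrow> bool" where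
  "involutary_rack R op \<longleftrightarrow> rack R op \<and> (\<forall>x\<in>R. \<forall>y\<in>R. op x (op x y) = y)"

definition kei :: "'u set \<Rightarrow> ('u \<Rightarrow> 'u \<Rightarrow> 'u) \<Rightarrow> bool" where
  "kei R op \<longleftrightarrow> quandle R op \<and> involutary_rack R op"

definition z2_set :: "'u set \<Rightarrow> ('u \<Rightarrow> 'u) \<Rightarrow> bool" where
  "z2_set S f \<longleftrightarrow> f \<in> S \<rightarrow> S \<and> (\<forall>x\<in>S. f (f x) = x)"

definition set_model :: "'u set \<Rightarrow> nat \<Rightarrow> nat \<Rightarrow> arr \<Rightarrow> 'u list \<Rightarrow> 'u list" where
  "set_model S = alg_model sets_pres S (\<lambda>_ _. undefined)"

definition z2_model :: "'u set \<Rightarrow> ('u \<Rightarrow> 'u) \<Rightarrow> nat \<Rightarrow> nat \<Rightarrow> arr \<Rightarrow> 'u list \<Rightarrow> 'u list" where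
  "z2_model S f = alg_model z2sets_pres S (\<lambda>_ xs. f (xs ! 0))"

definition invo_model :: "'u set \<Rightarrow> ('u \<Rightarrow> 'u \<Rightarrow> 'u) \<Rightarrow> nat \<Rightarrow> nat \<Rightarrow> arr \<Rightarrow> 'u list \<Rightarrow> 'u list" where
  "invo_model R op = alg_model invo_pres R (\<lambda>_ xs. op (xs ! 0) (xs ! 1))"

definition kei_model :: "'u set \<Rightarrow> ('u \<Rightarrow> 'u \<Rightarrow> 'u) \<Rightarrow> nat \<Rightarrow> nat \<Rightarrow> arr \<Rightarrow> 'u list \<Rightarrow> 'u list" where
  "kei_model R op = alg_model kei_pres R (\<lambda>_ xs. op (xs ! 0) (xs ! 1))"

lemma tuples_1: "xs \<in> tuples A (Suc 0) \<longleftrightarrow> (\<exists>x\<in>A. xs = [x])"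
  unfolding tuples_def by (auto simp: length_Suc_conv)

lemma tuples_2: "xs \<in> tuples A 2 \<longleftrightarrow> (\<exists>x\<in>A. \<exists>y\<in>A. xs = [x, y])"
  unfolding tuples_def by (auto simp: length_Suc_conv numeral_2_eq_2)

lemma ball_tuples:
  "(\<forall>xs\<in>tuples A (Suc 0). p xs) \<longleftrightarrow> (\<forall>x\<in>A. p [x])"
  "(\<forall>xs\<in>tuples A 2. p xs) \<longleftrightarrow> (\<forall>x\<in>A. \<forall>y\<in>A. p [x, y])"
  by (auto simp: tuples_1 tuples_2)

lemma wf_sets: "wf_pres sets_pres"
  by (simp add: wf_pres_def sets_pres_def)

lemma wf_z2sets: "wf_pres z2sets_pres"
  unfolding wf_pres_def z2sets_pres_def
  by (auto intro!: exI[of _ "1::nat"] trms.intros)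

lemma wf_invo: "wf_pres invo_pres"
  unfolding wf_pres_def invo_pres_def
  by (auto intro!: exI[of _ "3::nat"] trms.intros)

lemma wf_kei: "wf_pres kei_pres"
  unfolding wf_pres_def kei_pres_def invo_pres_def
  by (auto intro!: exI[of _ "3::nat"] trms.intros)

lemma algebra_sets: "algebra sets_pres S I"
  by (simp add: algebra_def sets_pres_def)

lemma all_valuations: "(\<forall>\<rho>::nat \<Rightarrow> 'u. range \<rho> \<subseteq> A \<longrightarrow> p (\<rho> 0) (\<rho> 1) (\<rho> 2)) \<longleftrightarrow>
    (\<forall>x\<in>A. \<forall>y\<in>A. \<forall>z\<in>A. p x y z)"
proof (intro iffI ballI)
  fix x y z assume a: "\<forall>\<rho>::nat \<Rightarrow> 'u. range \<rho> \<subseteq> A \<longrightarrow> p (\<rho> 0) (\<rho> 1) (\<rho> 2)"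
    and "x \<in> A" "y \<in> A" "z \<in> A"
  then show "p x y z"
    using a[rule_format, of "\<lambda>i. if i = 0 then x else if i = 1 then y else z"] by auto
qed (meson rangeI subsetD)

lemma algebra_z2sets:
  fixes f :: "'a \<Rightarrow> 'a"
  shows "algebra z2sets_pres S (\<lambda>_ xs. f (xs ! 0)) \<longleftrightarrow> z2_set S f"
proof -
  have "algebra z2sets_pres S (\<lambda>_ xs. f (xs ! 0)) \<longleftrightarrow>
      f \<in> S \<rightarrow> S \<and> (\<forall>\<rho>::nat \<Rightarrow> 'a. range \<rho> \<subseteq> S \<longrightarrow> f (f (\<rho> 0)) = \<rho> 0)"
    by (simp add: algebra_def z2sets_pres_def Pi_iff ball_tuples)
  then show ?thesis
    unfolding all_valuations[of S "\<lambda>x y z. f (f x) = x"] z2_set_def by blast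
qed

lemma involutary_rack_eq: "involutary_rack R op \<longleftrightarrow>
    (\<forall>x\<in>R. \<forall>y\<in>R. op x y \<in> R) \<and>
    (\<forall>x\<in>R. \<forall>y\<in>R. \<forall>z\<in>R. op x (op y z) = op (op x y) (op x z)) \<and>
    (\<forall>x\<in>R. \<forall>y\<in>R. op x (op x y) = y)"
proof -
  have "bij_betw (op x) R R \<longleftrightarrow> (\<forall>y\<in>R. op x y \<in> R)" if "\<forall>y\<in>R. op x (op x y) = y" for x
    using that bij_betw_byWitness[of R "op x" "op x" R] by (auto dest: bij_betwE)
  then show ?thesis unfolding involutary_rack_def rack_def by blast
qed

lemma algebra_invo:
  fixes op :: "'a \<Rightarrow> 'a \<Rightarrow> 'a"
  shows "algebra invo_pres R (\<lambda>_ xs. op (xs ! 0) (xs ! 1)) \<longleftrightarrow> involutary_rack R op"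
proof -
  have "algebra invo_pres R (\<lambda>_ xs. op (xs ! 0) (xs ! 1)) \<longleftrightarrow>
      (\<forall>x\<in>R. \<forall>y\<in>R. op x y \<in> R) \<and>
      (\<forall>\<rho>::nat \<Rightarrow> 'a. range \<rho> \<subseteq> R \<longrightarrow>
        op (\<rho> 0) (op (\<rho> 1) (\<rho> 2)) = op (op (\<rho> 0) (\<rho> 1)) (op (\<rho> 0) (\<rho> 2))) \<and>
      (\<forall>\<rho>::nat \<Rightarrow> 'a. range \<rho> \<subseteq> R \<longrightarrow> op (\<rho> 0) (op (\<rho> 0) (\<rho> 1)) = \<rho> 1)"
    by (simp add: algebra_def invo_pres_def Pi_iff ball_tuples)
  then show ?thesis
    unfolding all_valuations[of R "\<lambda>x y z. op x (op y z) = op (op x y) (op x z)"]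
      all_valuations[of R "\<lambda>x y z. op x (op x y) = y"] involutary_rack_eq by blast
qed

lemma algebra_kei:
  fixes op :: "'a \<Rightarrow> 'a \<Rightarrow> 'a"
  shows "algebra kei_pres R (\<lambda>_ xs. op (xs ! 0) (xs ! 1)) \<longleftrightarrow> kei R op"
proof -
  have "kei R op \<longleftrightarrow> involutary_rack R op \<and> (\<forall>x\<in>R. op x x = x)"
    unfolding kei_def quandle_def involutary_rack_def by blast
  moreover have "algebra kei_pres R (\<lambda>_ xs. op (xs ! 0) (xs ! 1)) \<longleftrightarrow>
      algebra invo_pres R (\<lambda>_ xs. op (xs ! 0) (xs ! 1)) \<and>
      (\<forall>\<rho>::nat \<Rightarrow> 'a. range \<rho> \<subseteq> R \<longrightarrow> op (\<rho> 0) (\<rho> 0) = \<rho> 0)"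
    by (auto simp: algebra_def kei_pres_def invo_pres_def)
  then have "algebra kei_pres R (\<lambda>_ xs. op (xs ! 0) (xs ! 1)) \<longleftrightarrow>
      algebra invo_pres R (\<lambda>_ xs. op (xs ! 0) (xs ! 1)) \<and> (\<forall>x\<in>R. op x x = x)"
    unfolding all_valuations[of R "\<lambda>x y z. op x x = x"] by blast
  ultimately show ?thesis unfolding algebra_invo by blast
qed

lemma alg_model_cong:
  assumes P: "wf_pres P" and I: "algebra P A I"
    and eq: "\<And>f xs. f \<in> Ops P \<Longrightarrow> xs \<in> tuples A (Ar P f) \<Longrightarrow> I f xs = I' f xs"
  shows "alg_model P A I = alg_model P A I'"
proof (intro ext)
  fix m n cs xs
  show "alg_model P A I m n cs xs = alg_model P A I' m n cs xs"
  proof (cases "cs \<in> Hom (theory_of P) m n \<and> xs \<in> tuples A m")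
    case True
    have "eval I ((!) xs) (rep c) = eval I' ((!) xs) (rep c)" if "c \<in> set cs" for c
    proof (rule eval_cong[THEN conjunct1, of _ P m _ _ A])
      show "rep c \<in> trms P m"
        using that True eqv_trms[OF P rep_cls] unfolding theory_of_sel by (auto simp: subset_iff)
    qed (use True eq I in \<open>auto simp: tuples_def algebra_def Pi_def\<close>)
    with True show ?thesis by (simp add: alg_model_def)
  qed (auto simp: alg_model_def)
qed

lemma algebra_cong:
  assumes P: "wf_pres P" and I: "algebra P A I"
    and eq: "\<And>f xs. f \<in> Ops P \<Longrightarrow> xs \<in> tuples A (Ar P f) \<Longrightarrow> I f xs = I' f xs"
  shows "algebra P A I'"
proof -
  have e: "eval I \<rho> t = eval I' \<rho> t" if "t \<in> trms P k" "range \<rho> \<subseteq> A" for t k \<rho>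
    by (rule eval_cong[OF that(1), THEN conjunct1, of _ _ A])
       (use that eq I in \<open>auto simp: algebra_def Pi_def\<close>)
  have "eval I' \<rho> l = eval I' \<rho> r" if lr: "(l, r) \<in> Eqs P" and \<rho>: "range \<rho> \<subseteq> A" for l r \<rho>
  proof -
    obtain k where k: "l \<in> trms P k" "r \<in> trms P k" using P lr unfolding wf_pres_def by blast
    have "eval I \<rho> l = eval I \<rho> r" using I lr \<rho> unfolding algebra_def by blast
    then show ?thesis using e[OF k(1) \<rho>] e[OF k(2) \<rho>] by simp
  qed
  moreover have "I' f \<in> tuples A (Ar P f) \<rightarrow> A" if f: "f \<in> Ops P" for f
  proof
    fix xs assume "xs \<in> tuples A (Ar P f)"
    then show "I' f xs \<in> A" using I f eq[of f xs] unfolding algebra_def by force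
  qed
  ultimately show ?thesis unfolding algebra_def by blast
qed

text \<open>The models of the four theories are the sets, \<open>\<int>/2\<close>-sets, involutary racks and kei.\<close>

lemma models_Sets: "models Sets S = {set_model S}"
proof -
  have e: "alg_model sets_pres S I = set_model S" for I
    unfolding set_model_def by (rule alg_model_cong[OF wf_sets algebra_sets]) (simp add: sets_pres_def)
  have "set_model S \<in> models Sets S"
    unfolding Sets_def set_model_def by (rule alg_model_in_models[OF wf_sets algebra_sets])
  moreover have "M = set_model S" if "M \<in> models Sets S" for M
    using model_is_alg_model[OF wf_sets that[unfolded Sets_def]] e by auto
  ultimately show ?thesis by blast
qed

lemma models_Z2Sets: "models Z2Sets S = {z2_model S f | f. z2_set S f}"
proof (intro equalityI subsetI)
  fix M assume "M \<in> models Z2Sets S"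
  then obtain I where I: "algebra z2sets_pres S I" "M = alg_model z2sets_pres S I"
    using model_is_alg_model[OF wf_z2sets] unfolding Z2Sets_def by blast
  let ?f = "\<lambda>x. I Act [x]"
  have e: "I f xs = ?f (xs ! 0)" if "f \<in> Ops z2sets_pres" "xs \<in> tuples S (Ar z2sets_pres f)" for f xs
    using that by (auto simp: z2sets_pres_def tuples_1)
  have "z2_set S ?f" "M = z2_model S ?f"
    using algebra_cong[OF wf_z2sets I(1) e, folded algebra_z2sets]
      alg_model_cong[OF wf_z2sets I(1) e] I(2)
    by (simp_all add: z2_model_def flip: algebra_z2sets)
  then show "M \<in> {z2_model S f | f. z2_set S f}" by blast
next
  fix M assume "M \<in> {z2_model S f | f. z2_set S f}"
  then show "M \<in> models Z2Sets S"
    using alg_model_in_models[OF wf_z2sets] unfolding Z2Sets_def z2_model_def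
    by (auto simp flip: algebra_z2sets)
qed

lemma models_Invo: "models Invo R = {invo_model R op | op. involutary_rack R op}"
proof (intro equalityI subsetI)
  fix M assume "M \<in> models Invo R"
  then obtain I where I: "algebra invo_pres R I" "M = alg_model invo_pres R I"
    using model_is_alg_model[OF wf_invo] unfolding Invo_def by blast
  let ?op = "\<lambda>x y. I Tri [x, y]"
  have e: "I f xs = ?op (xs ! 0) (xs ! 1)"
    if "f \<in> Ops invo_pres" "xs \<in> tuples R (Ar invo_pres f)" for f xs
    using that by (auto simp: invo_pres_def tuples_2)
  have "involutary_rack R ?op" "M = invo_model R ?op"
    using algebra_cong[OF wf_invo I(1) e] alg_model_cong[OF wf_invo I(1) e] I(2)
    by (simp_all add: invo_model_def flip: algebra_invo)
  then show "M \<in> {invo_model R op | op. involutary_rack R op}" by blast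
next
  fix M assume "M \<in> {invo_model R op | op. involutary_rack R op}"
  then show "M \<in> models Invo R"
    using alg_model_in_models[OF wf_invo] unfolding Invo_def invo_model_def
    by (auto simp flip: algebra_invo)
qed

lemma models_Kei: "models Kei R = {kei_model R op | op. kei R op}"
proof (intro equalityI subsetI)
  fix M assume "M \<in> models Kei R"
  then obtain I where I: "algebra kei_pres R I" "M = alg_model kei_pres R I"
    using model_is_alg_model[OF wf_kei] unfolding Kei_def by blast
  let ?op = "\<lambda>x y. I Tri [x, y]"
  have e: "I f xs = ?op (xs ! 0) (xs ! 1)"
    if "f \<in> Ops kei_pres" "xs \<in> tuples R (Ar kei_pres f)" for f xs
    using that by (auto simp: kei_pres_def tuples_2)
  have "kei R ?op" "M = kei_model R ?op"
    using algebra_cong[OF wf_kei I(1) e] alg_model_cong[OF wf_kei I(1) e] I(2)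
    by (simp_all add: kei_model_def flip: algebra_kei)
  then show "M \<in> {kei_model R op | op. kei R op}" by blast
next
  fix M assume "M \<in> {kei_model R op | op. kei R op}"
  then show "M \<in> models Kei R"
    using alg_model_in_models[OF wf_kei] unfolding Kei_def kei_model_def
    by (auto simp flip: algebra_kei)
qed

text \<open>
  The right adjoints of the four morphisms.  By \<open>right_adjoint_unique\<close> these determine the
  morphisms.
\<close>

lemma right_adjoint_can:
  assumes "involutary_rack R op"
  shows "theory_comp Z2Sets (invo_model R op) can = z2_model R (\<lambda>x. op x x)"
  unfolding Z2Sets_def invo_model_def can_def z2_model_def
  by (rule right_adjoint_interp[OF wf_z2sets _ iffD2[OF algebra_invo assms]])
     (auto simp: z2sets_pres_def invo_pres_def intro!: trms.intros)

lemma right_adjoint_ident: "theory_comp Z2Sets (set_model S) ident = z2_model S (\<lambda>x. x)"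
  unfolding Z2Sets_def set_model_def ident_def z2_model_def
  by (rule right_adjoint_interp[OF wf_z2sets])
     (auto simp: algebra_sets z2sets_pres_def intro!: trms.intros)

lemma right_adjoint_invo_to_kei:
  assumes "kei R op"
  shows "theory_comp Invo (kei_model R op) invo_to_kei = invo_model R op"
  unfolding Invo_def kei_model_def invo_to_kei_def extend_def invo_model_def
  by (rule right_adjoint_interp[OF wf_invo _ iffD2[OF algebra_kei assms]])
     (auto simp: kei_pres_def invo_pres_def numeral_2_eq_2 intro!: trms.intros)

lemma right_adjoint_sets_to_kei:
  assumes "kei R op"
  shows "theory_comp Sets (kei_model R op) sets_to_kei = set_model R"
  unfolding Sets_def kei_model_def sets_to_kei_def extend_def set_model_def
  by (rule right_adjoint_interp[OF wf_sets _ iffD2[OF algebra_kei assms]])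
     (auto simp: sets_pres_def)

end

theory Submission
  imports Defs
begin

text \<open>
  A morphism out of the theory of a presentation is determined by its values on the operations, so
  \<open>Sets\<close> is initial, and the square commutes because both composites send the
  action to \<open>x \<triangleright> x = x\<close>.  \<open>Kei\<close> has the same terms as \<open>Invo\<close> and one further equation
  \<open>x \<triangleright> x = x\<close>; hence a morphism out of \<open>Invo\<close> factors, uniquely, through \<open>Kei\<close> as soon as it
  respects this equation, that is, as soon as its composite with \<open>can\<close> sends the action to the
  identity, which is what a cocone over the span provides.
\<close>

section \<open>Theories of presentations\<close>

lemma Hom_theory_ofE:
  assumes "cs \<in> Hom (theory_of P) m n"
  obtains ts where "cs = map (cls P m) ts" "length ts = n" "set ts \<subseteq> trms P m"
  using assms unfolding theory_of_sel by blast

lemma Idn_theory_of: "Idn (theory_of P) n = map (cls P n) (map Var [0..<n])"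
  by (simp add: theory_of_sel)

lemma Vars_trms: "set (map Var [0..<n]) \<subseteq> trms P n"
  by (auto intro: trms.Var)

lemma map_subst_trms:
  assumes "set ss \<subseteq> trms P m" "length ts = m" "set ts \<subseteq> trms P l"
  shows "set (map (subst ((!) ts)) ss) \<subseteq> trms P l"
  using assms by (auto intro!: subst_trms simp: subset_iff)

text \<open>A form of \<open>Cmp_cls\<close> whose right side is again \<open>map (cls P l)\<close>
  of a list of terms, so that it rewrites iterated composites.\<close>

lemma Cmp_theory_of:
  assumes "wf_pres P" "length ts = m" "set ts \<subseteq> trms P l" "set ss \<subseteq> trms P m"
  shows "Cmp (theory_of P) l m n (map (cls P m) ss) (map (cls P l) ts)
    = map (cls P l) (map (subst ((!) ts)) ss)"
  using Cmp_cls[OF assms] by simp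

lemma subst_nth_Vars: "t \<in> trms P n \<Longrightarrow> subst ((!) (map Var [0..<n])) t = t"
  using subst_cong[of t P n "(!) (map Var [0..<n])" Var] by (simp add: subst_Var)

lemma App_Vars_trms: "f \<in> Ops P \<Longrightarrow> App f (map Var [0..<Ar P f]) \<in> trms P (Ar P f)"
  by (auto intro!: trms.intros)

text \<open>Composition is substitution on representatives, so the category laws are those of
  substitution; the power axiom holds because an arrow into \<open>n\<close> is literally the list
  of its components.\<close>

lemma lawvere_theory_theory_of:
  assumes P: "wf_pres P"
  shows "lawvere_theory (theory_of P)"
proof
  show "Idn (theory_of P) n \<in> Hom (theory_of P) n n" for n
    unfolding Idn_theory_of by (rule in_Hom[OF _ Vars_trms]) simp
next
  fix f l m g n
  assume "f \<in> Hom (theory_of P) l m" "g \<in> Hom (theory_of P) m n"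
  then obtain ts ss where ts: "f = map (cls P l) ts" "length ts = m" "set ts \<subseteq> trms P l"
    and ss: "g = map (cls P m) ss" "length ss = n" "set ss \<subseteq> trms P m"
    by (metis Hom_theory_ofE)
  show "Cmp (theory_of P) l m n g f \<in> Hom (theory_of P) l n"
    unfolding ts(1) ss(1) Cmp_theory_of[OF P ts(2,3) ss(3)]
    by (rule in_Hom[OF _ map_subst_trms[OF ss(3) ts(2,3)]]) (simp add: ss(2))
next
  fix f m n
  assume "f \<in> Hom (theory_of P) m n"
  then obtain ts where ts: "f = map (cls P m) ts" "length ts = n" "set ts \<subseteq> trms P m"
    by (rule Hom_theory_ofE)
  have "map (subst ((!) (map Var [0..<m]))) ts = ts"
    by (rule map_idI) (use ts in \<open>auto simp del: nth_map intro!: subst_nth_Vars\<close>)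
  then show "Cmp (theory_of P) m m n f (Idn (theory_of P) m) = f"
    unfolding Idn_theory_of ts(1) using Cmp_theory_of[OF P _ Vars_trms ts(3)] by simp
  have "map (subst ((!) ts)) (map Var [0..<n]) = ts"
    using ts(2) by (auto intro: nth_equalityI)
  then show "Cmp (theory_of P) m n n (Idn (theory_of P) n) f = f"
    unfolding Idn_theory_of ts(1) using Cmp_theory_of[OF P ts(2,3) Vars_trms] by simp
next
  fix f k l g m h n
  assume "f \<in> Hom (theory_of P) k l" "g \<in> Hom (theory_of P) l m" "h \<in> Hom (theory_of P) m n"
  then obtain ts ss us where ts: "f = map (cls P k) ts" "length ts = l" "set ts \<subseteq> trms P k"
    and ss: "g = map (cls P l) ss" "length ss = m" "set ss \<subseteq> trms P l"
    and us: "h = map (cls P m) us" "length us = n" "set us \<subseteq> trms P m"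
    by (metis Hom_theory_ofE)
  note C = Cmp_theory_of[OF P]
  \<comment> \<open>Associativity is \<open>subst_subst\<close>. The two substitutions applied to
    \<open>u\<close> need to agree only below \<open>m\<close>, the length of \<open>ss\<close>,
    since \<open>u\<close> is a term in \<open>m\<close> variables.\<close>
  have "subst ((!) (map (subst ((!) ts)) ss)) u = subst ((!) ts) (subst ((!) ss) u)"
    if "u \<in> set us" for u
    unfolding subst_subst by (rule subst_cong[of _ P m]) (use that us ss in auto)
  then show "Cmp (theory_of P) k m n h (Cmp (theory_of P) k l m g f)
      = Cmp (theory_of P) k l n (Cmp (theory_of P) l m n h g) f"
    unfolding ts(1) ss(1) us(1) C[OF ts(2,3) ss(3)] C[OF ss(2,3) us(3)]
      C[OF _ map_subst_trms[OF ss(3) ts(2,3)] us(3), unfolded length_map, OF ss(2)]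
      C[OF ts(2,3) map_subst_trms[OF us(3) ss(2,3)]]
    by simp
next
  show "Prj (theory_of P) n i \<in> Hom (theory_of P) n 1" if "i < n" for i n
    using in_Hom[of "[Var i]" 1 P n] that by (simp add: theory_of_sel trms.Var)
next
  show "Prj (theory_of P) 1 0 = Idn (theory_of P) 1"
    by (simp add: theory_of_sel)
next
  fix n m :: nat and p
  assume p: "\<And>i. i < n \<Longrightarrow> p i \<in> Hom (theory_of P) m 1"
  \<comment> \<open>Composing with a projection extracts an entry, so existence and uniqueness in
    the power axiom become statements about list entries.\<close>
  have proj: "Cmp (theory_of P) m n 1 (Prj (theory_of P) n i) f = [f ! i]"
    if f: "f \<in> Hom (theory_of P) m n" and i: "i < n" for f i
  proof -
    obtain ts where ts: "f = map (cls P m) ts" "length ts = n" "set ts \<subseteq> trms P m"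
      using f by (rule Hom_theory_ofE)
    show ?thesis
      using Cmp_theory_of[OF P ts(2,3), of "[Var i]" 1] i ts
      by (simp add: theory_of_sel(4) trms.Var)
  qed
  have "\<exists>t. t \<in> trms P m \<and> p i = [cls P m t]" if i: "i < n" for i
  proof -
    obtain ts where ts: "p i = map (cls P m) ts" "length ts = 1" "set ts \<subseteq> trms P m"
      using p[OF i] by (rule Hom_theory_ofE)
    then show ?thesis by (intro exI[of _ "hd ts"]) (auto simp: length_Suc_conv)
  qed
  then obtain t where t: "\<And>i. i < n \<Longrightarrow> t i \<in> trms P m \<and> p i = [cls P m (t i)]"
    by metis
  let ?f = "map (cls P m) (map t [0..<n])"
  have f: "?f \<in> Hom (theory_of P) m n"
    by (rule in_Hom) (use t in auto)
  show "\<exists>!f. f \<in> Hom (theory_of P) m n \<and>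
      (\<forall>i<n. Cmp (theory_of P) m n 1 (Prj (theory_of P) n i) f = p i)"
  proof (rule ex1I[of _ ?f])
    show "?f \<in> Hom (theory_of P) m n \<and>
        (\<forall>i<n. Cmp (theory_of P) m n 1 (Prj (theory_of P) n i) ?f = p i)"
      using f proj[OF f] t by simp
  next
    fix f' assume f': "f' \<in> Hom (theory_of P) m n \<and>
        (\<forall>i<n. Cmp (theory_of P) m n 1 (Prj (theory_of P) n i) f' = p i)"
    then have "length f' = n" by (auto elim: Hom_theory_ofE)
    then show "f' = ?f"
      using f' proj[of f'] t by (intro nth_equalityI) auto
  qed
qed


section \<open>Morphisms of theories\<close>

lemma theory_homI:
  assumes "\<And>m n. \<phi> m n \<in> Hom T m n \<rightarrow>\<^sub>E Hom T' m n"
    and "\<And>n. \<phi> n n (Idn T n) = Idn T' n"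
    and "\<And>l m n f g. f \<in> Hom T l m \<Longrightarrow> g \<in> Hom T m n \<Longrightarrow>
      \<phi> l n (Cmp T l m n g f) = Cmp T' l m n (\<phi> m n g) (\<phi> l m f)"
    and "\<And>n i. i < n \<Longrightarrow> \<phi> n 1 (Prj T n i) = Prj T' n i"
  shows "\<phi> \<in> theory_hom T T'"
  using assms unfolding theory_hom_def by blast

lemma
  assumes "\<phi> \<in> theory_hom T T'"
  shows theory_hom_Hom: "f \<in> Hom T m n \<Longrightarrow> \<phi> m n f \<in> Hom T' m n"
    and theory_hom_undefined: "f \<notin> Hom T m n \<Longrightarrow> \<phi> m n f = undefined"
    and theory_hom_Idn: "\<phi> n n (Idn T n) = Idn T' n"
    and theory_hom_Cmp: "f \<in> Hom T l m \<Longrightarrow> g \<in> Hom T m n \<Longrightarrow>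
      \<phi> l n (Cmp T l m n g f) = Cmp T' l m n (\<phi> m n g) (\<phi> l m f)"
    and theory_hom_Prj: "i < n \<Longrightarrow> \<phi> n 1 (Prj T n i) = Prj T' n i"
  using assms theory_hom_PiE[OF assms, of m n] unfolding theory_hom_def
  by (auto dest: PiE_mem PiE_arb)

lemma theory_comp_apply: "f \<in> Hom T m n \<Longrightarrow> theory_comp T \<psi> \<phi> m n f = \<psi> m n (\<phi> m n f)"
  by (simp add: theory_comp_def compose_def)

lemma theory_comp_hom:
  assumes T: "lawvere_theory T" and \<phi>: "\<phi> \<in> theory_hom T T'" and \<psi>: "\<psi> \<in> theory_hom T' T''"
  shows "theory_comp T \<psi> \<phi> \<in> theory_hom T T''"
proof (rule theory_homI)
  note [simp] = theory_comp_apply theory_hom_Hom[OF \<phi>] theory_hom_Hom[OF \<psi>]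
    lawvere_theory.idn_in[OF T] lawvere_theory.cmp_in[OF T] lawvere_theory.prj_in[OF T, simplified]
  show "theory_comp T \<psi> \<phi> m n \<in> Hom T m n \<rightarrow>\<^sub>E Hom T'' m n" for m n
    by (rule PiE_I) (auto simp: theory_comp_def compose_def)
  show "theory_comp T \<psi> \<phi> n n (Idn T n) = Idn T'' n" for n
    by (simp add: theory_hom_Idn[OF \<phi>] theory_hom_Idn[OF \<psi>])
  show "theory_comp T \<psi> \<phi> l n (Cmp T l m n g f)
      = Cmp T'' l m n (theory_comp T \<psi> \<phi> m n g) (theory_comp T \<psi> \<phi> l m f)"
    if "f \<in> Hom T l m" "g \<in> Hom T m n" for l m n f g
    using that by (simp add: theory_hom_Cmp[OF \<phi>] theory_hom_Cmp[OF \<psi>])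
  show "theory_comp T \<psi> \<phi> n 1 (Prj T n i) = Prj T'' n i" if "i < n" for n i
    using that theory_hom_Prj[OF \<phi> that] theory_hom_Prj[OF \<psi> that] by simp
qed

text \<open>The uniqueness half of \<open>power\<close>, taken at the components of
  \<open>f\<close>.\<close>

lemma (in lawvere_theory) hom_eqI:
  assumes "f \<in> Hom T m n" "f' \<in> Hom T m n"
    and "\<And>i. i < n \<Longrightarrow> Cmp T m n 1 (Prj T n i) f = Cmp T m n 1 (Prj T n i) f'"
  shows "f = f'"
  using power[of n "\<lambda>i. Cmp T m n 1 (Prj T n i) f" m] assms
  by (metis cmp_in prj_in)

section \<open>Morphisms out of the theory of a presentation\<close>

context
  fixes P :: "('f, 'x) presentation_scheme" and T :: "'a lawvere"
  assumes P: "wf_pres P" and T: "lawvere_theory T"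
begin

text \<open>Functoriality seen on terms: substitution is composition in \<open>theory_of P\<close>,
  so a morphism turns it into composition in \<open>T\<close>.\<close>

lemma hom_subst:
  assumes \<phi>: "\<phi> \<in> theory_hom (theory_of P) T"
    and ts: "length ts = k" "set ts \<subseteq> trms P m" and ss: "length ss = n" "set ss \<subseteq> trms P k"
  shows "\<phi> m n (map (cls P m) (map (subst ((!) ts)) ss))
    = Cmp T m k n (\<phi> k n (map (cls P k) ss)) (\<phi> m k (map (cls P m) ts))"
  using theory_hom_Cmp[OF \<phi> in_Hom[OF ts] in_Hom[OF ss]]
  unfolding Cmp_theory_of[OF P ts ss(2)] .

text \<open>The case of \<open>hom_subst\<close> in which the outer term is a variable, that is, a
  projection.\<close>

lemma hom_component:
  assumes \<phi>: "\<phi> \<in> theory_hom (theory_of P) T"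
    and ts: "length ts = n" "set ts \<subseteq> trms P m" and i: "i < n"
  shows "\<phi> m 1 [cls P m (ts ! i)] = Cmp T m n 1 (Prj T n i) (\<phi> m n (map (cls P m) ts))"
  using hom_subst[OF \<phi> ts, of "[Var i]" 1] theory_hom_Prj[OF \<phi> i] i
  by (simp add: theory_of_sel(4) trms.Var)

text \<open>Reduces tuples to single terms by \<open>hom_eqI\<close>. With \<open>ts = ss\<close> it
  compares two morphisms; with \<phi> = \<psi> it says that one morphism does not distinguish two
  tuples.\<close>

lemma hom_values_eqI:
  assumes \<phi>: "\<phi> \<in> theory_hom (theory_of P) T" and \<psi>: "\<psi> \<in> theory_hom (theory_of P) T"
    and ts: "length ts = n" "set ts \<subseteq> trms P m" and ss: "length ss = n" "set ss \<subseteq> trms P m"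
    and eq: "\<And>i. i < n \<Longrightarrow> \<phi> m 1 [cls P m (ts ! i)] = \<psi> m 1 [cls P m (ss ! i)]"
  shows "\<phi> m n (map (cls P m) ts) = \<psi> m n (map (cls P m) ss)"
  by (rule lawvere_theory.hom_eqI[OF T theory_hom_Hom[OF \<phi> in_Hom[OF ts]]
        theory_hom_Hom[OF \<psi> in_Hom[OF ss]]])
     (metis eq hom_component[OF \<phi> ts] hom_component[OF \<psi> ss])

text \<open>\<open>App f ts\<close> is the generic application of \<open>f\<close> with
  \<open>ts\<close> substituted for the variables, so this is \<open>hom_subst\<close> again; it
  drives the inductions over terms and derivations.\<close>

lemma hom_App:
  assumes \<phi>: "\<phi> \<in> theory_hom (theory_of P) T"
    and f: "f \<in> Ops P" and ts: "length ts = Ar P f" "set ts \<subseteq> trms P m"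
  shows "\<phi> m 1 [cls P m (App f ts)]
    = Cmp T m (Ar P f) 1 (\<phi> (Ar P f) 1 [cls P (Ar P f) (App f (map Var [0..<Ar P f]))])
        (\<phi> m (Ar P f) (map (cls P m) ts))"
proof -
  have "subst ((!) ts) (App f (map Var [0..<Ar P f])) = App f ts"
    using ts by (auto intro: nth_equalityI)
  then show ?thesis
    using hom_subst[OF \<phi> ts, of "[App f (map Var [0..<Ar P f])]" 1] App_Vars_trms[OF f]
    by (simp del: subst.simps)
qed

text \<open>Induction on terms: variables are projections, which both morphisms preserve, and
  \<open>hom_App\<close> reduces an application to the operation and its arguments. Tuples follow
  entrywise.\<close>

lemma theory_hom_eqI:
  assumes \<phi>: "\<phi> \<in> theory_hom (theory_of P) T" and \<psi>: "\<psi> \<in> theory_hom (theory_of P) T"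
    and eq: "\<And>f. f \<in> Ops P \<Longrightarrow>
      \<phi> (Ar P f) 1 [cls P (Ar P f) (App f (map Var [0..<Ar P f]))]
      = \<psi> (Ar P f) 1 [cls P (Ar P f) (App f (map Var [0..<Ar P f]))]"
  shows "\<phi> = \<psi>"
proof (intro ext)
  fix m n cs
  have 1: "\<phi> m 1 [cls P m t] = \<psi> m 1 [cls P m t]" if "t \<in> trms P m" for t
    using that
  proof induction
    case (Var i)
    then show ?case
      using theory_hom_Prj[OF \<phi> Var] theory_hom_Prj[OF \<psi> Var] by (simp add: theory_of_sel)
  next
    case (App f ts)
    then have ts: "length ts = Ar P f" "set ts \<subseteq> trms P m" by auto
    have "\<phi> m (Ar P f) (map (cls P m) ts) = \<psi> m (Ar P f) (map (cls P m) ts)"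
      by (rule hom_values_eqI[OF \<phi> \<psi> ts ts]) (use App in simp)
    then show ?case
      unfolding hom_App[OF \<phi> App(1) ts] hom_App[OF \<psi> App(1) ts] eq[OF App(1)] by simp
  qed
  show "\<phi> m n cs = \<psi> m n cs"
  proof (cases "cs \<in> Hom (theory_of P) m n")
    case True
    then obtain ts where ts: "cs = map (cls P m) ts" "length ts = n" "set ts \<subseteq> trms P m"
      by (rule Hom_theory_ofE)
    show ?thesis
      unfolding ts(1) by (rule hom_values_eqI[OF \<phi> \<psi> ts(2,3) ts(2,3)], rule 1) (use ts in auto)
  qed (simp add: theory_hom_undefined[OF \<phi>] theory_hom_undefined[OF \<psi>])
qed

end


section \<open>Interpretations of presentations\<close>

text \<open>In the induction step both sides substitute into \<open>J f\<close>; as this term has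
  only \<open>Ar P f\<close> variables, indices beyond the argument list do not matter.\<close>

lemma translate_subst:
  assumes "\<And>f. f \<in> Ops P \<Longrightarrow> J f \<in> trms Q (Ar P f)" "t \<in> trms P m"
  shows "translate J (subst \<sigma> t) = subst (\<lambda>i. translate J (\<sigma> i)) (translate J t)"
  using assms(2)
proof induction
  case (App f ts)
  then show ?case
    by (simp add: subst_subst o_def) (rule subst_cong[OF assms(1)], auto)
qed simp

context
  fixes P :: "('f, 'x) presentation_scheme" and Q :: "('g, 'y) presentation_scheme"
    and J :: "'f \<Rightarrow> 'g trm"
  assumes P: "wf_pres P" and Q: "wf_pres Q"
    and J: "\<And>f. f \<in> Ops P \<Longrightarrow> J f \<in> trms Q (Ar P f)"
    and ax: "\<And>l r. (l, r) \<in> Eqs P \<Longrightarrow> \<exists>k. eqv Q k (translate J l) (translate J r)"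
begin

text \<open>Induction on derivations. By \<open>translate_subst\<close> an instance of an axiom
  translates to an instance of the translated axiom, which is derivable in \<open>Q\<close> by
  \<open>ax\<close>.\<close>

lemma eqv_translate: "eqv P m s t \<Longrightarrow> eqv Q m (translate J s) (translate J t)"
proof (induction rule: eqv.induct)
  case (Ax l r \<sigma>)
  obtain k where k: "l \<in> trms P k" "r \<in> trms P k" using P Ax(1) unfolding wf_pres_def by blast
  obtain k' where "eqv Q k' (translate J l) (translate J r)" using ax[OF Ax(1)] by blast
  then have "eqv Q m (subst (\<lambda>i. translate J (\<sigma> i)) (translate J l))
      (subst (\<lambda>i. translate J (\<sigma> i)) (translate J r))"
    by (rule eqv_subst[OF _ _ Q]) (rule translate_trms[OF J Ax(2)])
  then show ?case
    using translate_subst[of P J Q, OF J] k by metis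
next
  case (Refl t)
  then show ?case by (blast intro: eqv.Refl translate_trms[of P J Q, OF J])
next
  case (Cong f ss ts)
  then have "eqv Q m (map (translate J) ss ! i) (map (translate J) ts ! i)" if "i < Ar P f" for i
    using that by (auto simp: list_all2_conv_all_nth)
  then show ?case using eqv_subst2[OF J[OF Cong(1)]] by simp
qed (blast intro: eqv.intros)+

text \<open>\<open>eqv_translate\<close> makes the result independent of the terms picked by
  \<open>rep\<close>.\<close>

lemma interp_cls:
  assumes "length ts = n" "set ts \<subseteq> trms P m"
  shows "interp P Q J m n (map (cls P m) ts) = map (cls Q m) (map (translate J) ts)"
proof -
  have "cls Q m (translate J (rep (cls P m t))) = cls Q m (translate J t)" if "t \<in> set ts" for t
    by (rule cls_eq[OF eqv.Sym[OF eqv_translate[OF rep_cls]]]) (use that assms in auto)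
  then show ?thesis using in_Hom[OF assms] by (simp add: interp_def)
qed

lemma interp_hom: "interp P Q J \<in> theory_hom (theory_of P) (theory_of Q)"
proof (rule theory_homI)
  have tr: "set (map (translate J) ts) \<subseteq> trms Q m" if "set ts \<subseteq> trms P m" for ts m
    using that translate_trms[of P J Q, OF J] by auto
  show "interp P Q J m n \<in> Hom (theory_of P) m n \<rightarrow>\<^sub>E Hom (theory_of Q) m n" for m n
  proof (rule PiE_I)
    fix cs assume "cs \<in> Hom (theory_of P) m n"
    then obtain ts where ts: "cs = map (cls P m) ts" "length ts = n" "set ts \<subseteq> trms P m"
      by (rule Hom_theory_ofE)
    show "interp P Q J m n cs \<in> Hom (theory_of Q) m n"
      unfolding ts(1) interp_cls[OF ts(2,3)] by (rule in_Hom[OF _ tr[OF ts(3)]]) (simp add: ts(2))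
  qed (simp add: interp_def)
  show "interp P Q J n n (Idn (theory_of P) n) = Idn (theory_of Q) n" for n
    unfolding Idn_theory_of by (subst interp_cls[OF _ Vars_trms]) simp_all
  show "interp P Q J n 1 (Prj (theory_of P) n i) = Prj (theory_of Q) n i" if "i < n" for n i
    using interp_cls[of "[Var i]" 1 n] that by (simp add: theory_of_sel(4) trms.Var)
  fix l m n f g
  assume "f \<in> Hom (theory_of P) l m" "g \<in> Hom (theory_of P) m n"
  then obtain ts ss where ts: "f = map (cls P l) ts" "length ts = m" "set ts \<subseteq> trms P l"
    and ss: "g = map (cls P m) ss" "length ss = n" "set ss \<subseteq> trms P m"
    by (metis Hom_theory_ofE)
  have "translate J (subst ((!) ts) s) = subst ((!) (map (translate J) ts)) (translate J s)"
    if "s \<in> set ss" for s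
  proof -
    have s: "s \<in> trms P m" using that ss by blast
    have "translate J (subst ((!) ts) s) = subst (\<lambda>i. translate J (ts ! i)) (translate J s)"
      by (rule translate_subst[OF _ s]) (rule J)
    also have "\<dots> = subst ((!) (map (translate J) ts)) (translate J s)"
      by (rule subst_cong[OF translate_trms[of P J Q, OF J s]]) (use ts(2) in auto)
    finally show ?thesis .
  qed
  then have "map (translate J) (map (subst ((!) ts)) ss)
      = map (subst ((!) (map (translate J) ts))) (map (translate J) ss)"
    by simp
  then show "interp P Q J l n (Cmp (theory_of P) l m n g f)
      = Cmp (theory_of Q) l m n (interp P Q J m n g) (interp P Q J l m f)"
    unfolding ts(1) ss(1) Cmp_theory_of[OF P ts(2,3) ss(3)] interp_cls[OF ts(2,3)]
      interp_cls[OF ss(2,3)]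
    by (subst interp_cls[OF _ map_subst_trms[OF ss(3) ts(2,3)]],
        use ss in simp,
        subst Cmp_theory_of[OF Q _ tr[OF ts(3)] tr[OF ss(3)]])
       (use ts in simp_all)
qed

end

section \<open>Inclusions of presentations\<close>

lemma translate_extend:
  "t \<in> trms P m \<Longrightarrow> translate (\<lambda>f. App f (map Var [0..<Ar P f])) t = t"
proof (induction rule: trms.induct)
  case (App f ts)
  then show ?case by (auto intro: nth_equalityI)
qed simp

lemma trms_mono:
  assumes "Ops P \<subseteq> Ops Q" "Ar P = Ar Q" "t \<in> trms P m"
  shows "t \<in> trms Q m"
  using assms(3) by induction (use assms in \<open>auto intro!: trms.intros\<close>)

context
  fixes P :: "('f, 'x) presentation_scheme" and Q :: "('f, 'y) presentation_scheme"
  assumes P: "wf_pres P" and Q: "wf_pres Q"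
    and sub: "Ops P \<subseteq> Ops Q" "Ar P = Ar Q" "Eqs P \<subseteq> Eqs Q"
begin

lemma extend_axioms:
  "f \<in> Ops P \<Longrightarrow> App f (map Var [0..<Ar P f]) \<in> trms Q (Ar P f)"
  "(l, r) \<in> Eqs P \<Longrightarrow> \<exists>k. eqv Q k (translate (\<lambda>f. App f (map Var [0..<Ar P f])) l)
      (translate (\<lambda>f. App f (map Var [0..<Ar P f])) r)"
proof -
  show "App f (map Var [0..<Ar P f]) \<in> trms Q (Ar P f)" if "f \<in> Ops P"
    using trms_mono[OF sub(1,2) App_Vars_trms[OF that]] .
  assume lr: "(l, r) \<in> Eqs P"
  then obtain k where k: "k > 0" "l \<in> trms P k" "r \<in> trms P k"
    using P unfolding wf_pres_def by blast
  \<comment> \<open>The rule \<open>eqv.Ax\<close> demands a term in \<open>k\<close> variables at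
    every index, so \<open>Var\<close> itself is not admissible; indices from \<open>k\<close> on
    are sent to \<open>Var 0\<close>, which is such a term because \<open>k > 0\<close>.\<close>
  let ?\<sigma> = "\<lambda>i. Var (if i < k then i else 0)"
  have "eqv Q k (subst ?\<sigma> l) (subst ?\<sigma> r)"
    by (rule eqv.Ax) (use lr sub k in \<open>auto intro: trms.Var\<close>)
  moreover have "subst ?\<sigma> t = t" if "t \<in> trms P k" for t
    by (rule trans[OF subst_cong[OF that, where \<tau> = Var] subst_Var]) simp
  ultimately have "eqv Q k l r" using k by simp
  then show "\<exists>k. eqv Q k (translate (\<lambda>f. App f (map Var [0..<Ar P f])) l)
      (translate (\<lambda>f. App f (map Var [0..<Ar P f])) r)"
    using translate_extend k by metis
qed

lemma extend_hom: "extend P Q \<in> theory_hom (theory_of P) (theory_of Q)"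
  unfolding extend_def by (rule interp_hom[OF P Q]) (rule extend_axioms, assumption)+

text \<open>Translation along the inclusion fixes terms by \<open>translate_extend\<close>; only the
  congruence that forms their classes changes.\<close>

lemma extend_cls:
  assumes "length ts = n" "set ts \<subseteq> trms P m"
  shows "extend P Q m n (map (cls P m) ts) = map (cls Q m) ts"
proof -
  have "map (translate (\<lambda>f. App f (map Var [0..<Ar P f]))) ts = ts"
    by (rule map_idI) (use assms translate_extend in auto)
  then show ?thesis
    unfolding extend_def
    by (subst interp_cls[OF P Q _ _ assms]) (use extend_axioms in auto)
qed

end


section \<open>Adding equations to a presentation\<close>

context
  fixes P :: "('f, 'x) presentation_scheme" and Q :: "('f, 'y) presentation_scheme"
    and T :: "'a lawvere"
  assumes P: "wf_pres P" and Q: "wf_pres Q"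
    and same: "Ops P = Ops Q" "Ar P = Ar Q" and sub: "Eqs P \<subseteq> Eqs Q"
begin

lemma trms_same: "trms P m = trms Q m"
  using trms_mono[of P Q] trms_mono[of Q P] same by auto

text \<open>Both presentations have the same terms, so \<open>extend P Q\<close> is surjective on
  hom sets and can be cancelled on the right.\<close>

lemma hom_from_extension_unique:
  assumes h: "h \<in> theory_hom (theory_of Q) T" and h': "h' \<in> theory_hom (theory_of Q) T"
    and eq: "theory_comp (theory_of P) h (extend P Q) = theory_comp (theory_of P) h' (extend P Q)"
  shows "h = h'"
proof (intro ext)
  fix m n cs
  show "h m n cs = h' m n cs"
  proof (cases "cs \<in> Hom (theory_of Q) m n")
    case True
    then obtain ts where ts: "cs = map (cls Q m) ts" "length ts = n" "set ts \<subseteq> trms P m"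
      unfolding trms_same by (rule Hom_theory_ofE)
    have "extend P Q m n (map (cls P m) ts) = cs"
      using extend_cls[OF P Q _ same(2) sub ts(2,3)] same ts by simp
    then show ?thesis
      using fun_cong[OF fun_cong[OF fun_cong[OF eq, of m], of n], of "map (cls P m) ts"]
        theory_comp_apply[OF in_Hom[OF ts(2,3)]] by metis
  qed (simp add: theory_hom_undefined[OF h] theory_hom_undefined[OF h'])
qed

text \<open>The pairs of terms that \<open>g\<close> identifies form a congruence closed under
  substitution. If it contains the axioms of \<open>Q\<close>, it contains everything derivable from
  them.\<close>

lemma hom_respects_extension:
  assumes T: "lawvere_theory T" and g: "g \<in> theory_hom (theory_of P) T"
    and ax: "\<And>l r. (l, r) \<in> Eqs Q \<Longrightarrow>
      \<exists>k. l \<in> trms P k \<and> r \<in> trms P k \<and> g k 1 [cls P k l] = g k 1 [cls P k r]"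
    and st: "eqv Q m s t"
  shows "g m 1 [cls P m s] = g m 1 [cls P m t]"
  using st
proof (induction rule: eqv.induct)
  case (Ax l r \<sigma>)
  then obtain k where k: "l \<in> trms P k" "r \<in> trms P k" "g k 1 [cls P k l] = g k 1 [cls P k r]"
    using ax by blast
  \<comment> \<open>The values of \<sigma> at the \<open>k\<close> variables form an arrow from
    \<open>m\<close> to \<open>k\<close>; composing with its image under \<open>g\<close> carries
    the equality of the two sides of the axiom over to the instance.\<close>
  let ?ts = "map \<sigma> [0..<k]"
  have ts: "length ?ts = k" "set ?ts \<subseteq> trms P m" using Ax(2) trms_same by auto
  have "g m 1 [cls P m (subst \<sigma> u)]
      = Cmp T m k 1 (g k 1 [cls P k u]) (g m k (map (cls P m) ?ts))" if "u \<in> trms P k" for u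
  proof -
    have "subst \<sigma> u = subst ((!) ?ts) u" by (rule subst_cong[OF that]) simp
    then show ?thesis using hom_subst[OF P T g ts, of "[u]" 1] that by simp
  qed
  then show ?case using k by metis
next
  case (Cong f ss ts)
  have len: "length ss = Ar P f" "length ts = Ar P f"
    using Cong same by (auto simp: list_all2_conv_all_nth)
  have trm: "ss ! i \<in> trms P m" "ts ! i \<in> trms P m" if "i < Ar P f" for i
    using Cong(3) that len eqv_trms[OF Q] trms_same by (auto simp: list_all2_conv_all_nth)
  then have sets: "set ss \<subseteq> trms P m" "set ts \<subseteq> trms P m"
    using len by (auto simp: in_set_conv_nth)
  have "g m (Ar P f) (map (cls P m) ss) = g m (Ar P f) (map (cls P m) ts)"
    by (rule hom_values_eqI[OF P T g g len(1) sets(1) len(2) sets(2)])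
       (use Cong(3) len in \<open>auto simp: list_all2_conv_all_nth\<close>)
  moreover have "f \<in> Ops P" using Cong(1) same by simp
  ultimately show ?case
    using hom_App[OF P T g _ len(1) sets(1)] hom_App[OF P T g _ len(2) sets(2)] by simp
qed auto

text \<open>Universal property of a quotient: \<open>theory_of Q\<close> consists of coarser classes
  of the same terms, and \<open>g\<close> descends to them by
  \<open>hom_respects_extension\<close>.\<close>

lemma hom_from_extension_exists:
  assumes T: "lawvere_theory T" and g: "g \<in> theory_hom (theory_of P) T"
    and ax: "\<And>l r. (l, r) \<in> Eqs Q \<Longrightarrow>
      \<exists>k. l \<in> trms P k \<and> r \<in> trms P k \<and> g k 1 [cls P k l] = g k 1 [cls P k r]"
  shows "\<exists>h \<in> theory_hom (theory_of Q) T. theory_comp (theory_of P) h (extend P Q) = g"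
proof
  define h where
    "h = (\<lambda>m n. \<lambda>cs\<in>Hom (theory_of Q) m n. g m n (map (\<lambda>c. cls P m (rep c)) cs))"
  have h_cls: "h m n (map (cls Q m) ts) = g m n (map (cls P m) ts)"
    if ts: "length ts = n" "set ts \<subseteq> trms P m" for m n ts
  proof -
    \<comment> \<open>The entries of \<open>?ss\<close> are the terms that \<open>h\<close> picks.
      They agree with those of \<open>ts\<close> modulo the equations of \<open>Q\<close>, which
      \<open>g\<close> respects.\<close>
    let ?ss = "map (\<lambda>t. rep (cls Q m t)) ts"
    have eqv: "eqv Q m (ts ! i) (?ss ! i)" if "i < n" for i
      using rep_cls[of "ts ! i" Q m] that ts trms_same by (auto simp: subset_iff)
    then have "?ss ! i \<in> trms P m" if "i < n" for i
      using that eqv_trms[OF Q] trms_same by blast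
    then have ss: "length ?ss = n" "set ?ss \<subseteq> trms P m"
      using ts by (auto simp: in_set_conv_nth)
    have "g m n (map (cls P m) ?ss) = g m n (map (cls P m) ts)"
      by (rule hom_values_eqI[OF P T g g ss ts])
         (rule hom_respects_extension[OF T g ax eqv.Sym[OF eqv]])
    moreover have "map (cls Q m) ts \<in> Hom (theory_of Q) m n"
      using in_Hom ts trms_same by metis
    ultimately show ?thesis by (simp add: h_def o_def)
  qed
  show "theory_comp (theory_of P) h (extend P Q) = g"
  proof (intro ext)
    fix m n cs
    show "theory_comp (theory_of P) h (extend P Q) m n cs = g m n cs"
    proof (cases "cs \<in> Hom (theory_of P) m n")
      case True
      then obtain ts where ts: "cs = map (cls P m) ts" "length ts = n" "set ts \<subseteq> trms P m"
        by (rule Hom_theory_ofE)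
      show ?thesis
        unfolding theory_comp_apply[OF True]
        using extend_cls[OF P Q _ same(2) sub ts(2,3)] same h_cls[OF ts(2,3)] ts(1) by simp
    qed (simp add: theory_hom_undefined[OF g] theory_comp_def compose_def)
  qed
  show "h \<in> theory_hom (theory_of Q) T"
  proof (rule theory_homI)
    show "h m n \<in> Hom (theory_of Q) m n \<rightarrow>\<^sub>E Hom T m n" for m n
    proof (rule PiE_I)
      fix cs assume "cs \<in> Hom (theory_of Q) m n"
      then obtain ts where ts: "cs = map (cls Q m) ts" "length ts = n" "set ts \<subseteq> trms P m"
        unfolding trms_same by (rule Hom_theory_ofE)
      show "h m n cs \<in> Hom T m n"
        unfolding ts(1) h_cls[OF ts(2,3)] by (rule theory_hom_Hom[OF g in_Hom[OF ts(2,3)]])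
    qed (simp add: h_def)
    show "h n n (Idn (theory_of Q) n) = Idn T n" for n
      unfolding Idn_theory_of
      using h_cls[OF _ Vars_trms] theory_hom_Idn[OF g, unfolded Idn_theory_of] by simp
    show "h n 1 (Prj (theory_of Q) n i) = Prj T n i" if "i < n" for n i
      using h_cls[of "[Var i]" 1 n] theory_hom_Prj[OF g that] that
      by (simp add: theory_of_sel(4) trms.Var)
    fix l m n x y
    assume "x \<in> Hom (theory_of Q) l m" "y \<in> Hom (theory_of Q) m n"
    then obtain ts ss where ts: "x = map (cls Q l) ts" "length ts = m" "set ts \<subseteq> trms P l"
      and ss: "y = map (cls Q m) ss" "length ss = n" "set ss \<subseteq> trms P m"
      unfolding trms_same by (metis Hom_theory_ofE)
    have "h l n (Cmp (theory_of Q) l m n y x) = g l n (map (cls P l) (map (subst ((!) ts)) ss))"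
      unfolding ts(1) ss(1)
        Cmp_theory_of[OF Q ts(2) ts(3)[unfolded trms_same] ss(3)[unfolded trms_same]]
      by (rule h_cls[OF _ map_subst_trms[OF ss(3) ts(2,3)]]) (simp add: ss(2))
    also have "\<dots> = Cmp T l m n (h m n y) (h l m x)"
      unfolding hom_subst[OF P T g ts(2,3) ss(2,3)] ts(1) ss(1) h_cls[OF ts(2,3)] h_cls[OF ss(2,3)] ..
    finally show "h l n (Cmp (theory_of Q) l m n y x) = Cmp T l m n (h m n y) (h l m x)" .
  qed
qed

end


section \<open>The square\<close>

lemma Var_trms [simp]: "Var i \<in> trms P m \<longleftrightarrow> i < m"
  by (auto intro: trms.Var elim: trms.cases)

lemma tri_trms_invo [simp]:
  "s \<triangleright> t \<in> trms invo_pres m \<longleftrightarrow> s \<in> trms invo_pres m \<and> t \<in> trms invo_pres m"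
proof
  show "s \<triangleright> t \<in> trms invo_pres m \<Longrightarrow> s \<in> trms invo_pres m \<and> t \<in> trms invo_pres m"
    by (auto elim: trms.cases)
qed (auto intro!: trms.App simp: invo_pres_def)

lemma Act_trms [simp]: "App Act [t] \<in> trms z2sets_pres m \<longleftrightarrow> t \<in> trms z2sets_pres m"
proof
  show "App Act [t] \<in> trms z2sets_pres m \<Longrightarrow> t \<in> trms z2sets_pres m"
    by (auto elim: trms.cases)
qed (auto intro!: trms.App simp: z2sets_pres_def)

lemma invo_kei:
  "Ops invo_pres = Ops kei_pres" "Ar invo_pres = Ar kei_pres" "Eqs invo_pres \<subseteq> Eqs kei_pres"
  by (auto simp: invo_pres_def kei_pres_def)

lemma sets_kei:
  "Ops sets_pres \<subseteq> Ops kei_pres" "Ar sets_pres = Ar kei_pres" "Eqs sets_pres \<subseteq> Eqs kei_pres"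
  by (auto simp: sets_pres_def kei_pres_def)

lemma eqv_invo_cancel:
  assumes "s \<in> trms invo_pres m" "t \<in> trms invo_pres m"
  shows "eqv invo_pres m (s \<triangleright> (s \<triangleright> t)) t"
  using eqv.Ax[of "Var 0 \<triangleright> (Var 0 \<triangleright> Var 1)" "Var 1" invo_pres
      "\<lambda>i. if i = 0 then s else t" m] assms
  by (simp add: invo_pres_def)

lemma eqv_invo_distrib:
  assumes "s \<in> trms invo_pres m" "t \<in> trms invo_pres m" "u \<in> trms invo_pres m"
  shows "eqv invo_pres m (s \<triangleright> (t \<triangleright> u)) ((s \<triangleright> t) \<triangleright> (s \<triangleright> u))"
  using eqv.Ax[of "Var 0 \<triangleright> (Var 1 \<triangleright> Var 2)" "(Var 0 \<triangleright> Var 1) \<triangleright> (Var 0 \<triangleright> Var 2)" invo_pres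
      "\<lambda>i. if i = 0 then s else if i = 1 then t else u" m] assms
  by (simp add: invo_pres_def)

text \<open>
  \<open>F\<^sup>2 = id\<close> in an involutary rack: distributivity gives \<open>x \<triangleright> (x \<triangleright> x) = F(x) \<triangleright> F(x)\<close>, and the
  left side is \<open>x\<close>.
\<close>

lemma eqv_invo_F_F:
  assumes t: "t \<in> trms invo_pres m"
  shows "eqv invo_pres m ((t \<triangleright> t) \<triangleright> (t \<triangleright> t)) t"
  by (rule eqv.Trans[OF eqv.Sym[OF eqv_invo_distrib[OF t t t]] eqv_invo_cancel[OF t t]])

text \<open>The axiom of an involution translates to \<open>F (F x) = x\<close> with
  \<open>F x = x \<triangleright> x\<close>, which is \<open>eqv_invo_F_F\<close> at a
  variable.\<close>

lemma can_axioms: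
  "f \<in> Ops z2sets_pres \<Longrightarrow> Var 0 \<triangleright> Var 0 \<in> trms invo_pres (Ar z2sets_pres f)"
  "(l, r) \<in> Eqs z2sets_pres \<Longrightarrow>
    \<exists>k. eqv invo_pres k (translate (\<lambda>_. Var 0 \<triangleright> Var 0) l) (translate (\<lambda>_. Var 0 \<triangleright> Var 0) r)"
  using eqv_invo_F_F[of "Var 0" 1] by (auto simp: z2sets_pres_def)

lemma ident_axioms:
  "f \<in> Ops z2sets_pres \<Longrightarrow> Var 0 \<in> trms sets_pres (Ar z2sets_pres f)"
  "(l, r) \<in> Eqs z2sets_pres \<Longrightarrow>
    \<exists>k. eqv sets_pres k (translate (\<lambda>_. Var 0) l) (translate (\<lambda>_. Var 0) r)"
  using eqv.Refl[of "Var 0" sets_pres 1] by (auto simp: z2sets_pres_def)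

section \<open>The four morphisms and their values on the action\<close>

lemma can_hom: "can \<in> theory_hom Z2Sets Invo"
  unfolding can_def Z2Sets_def Invo_def
  by (rule interp_hom[OF wf_z2sets wf_invo]) (rule can_axioms, assumption)+

lemma can_Act:
  "can 1 1 [cls z2sets_pres 1 (App Act [Var 0])] = [cls invo_pres 1 (Var 0 \<triangleright> Var 0)]"
  unfolding can_def
  using interp_cls[OF wf_z2sets wf_invo can_axioms, of "[App Act [Var 0]]" 1 1] by simp

lemma ident_hom: "ident \<in> theory_hom Z2Sets Sets"
  unfolding ident_def Z2Sets_def Sets_def
  by (rule interp_hom[OF wf_z2sets wf_sets]) (rule ident_axioms, assumption)+

text \<open>The value is phrased as an identity arrow because every morphism out of
  \<open>Sets\<close> preserves identities, which evaluates any composite with \<open>ident\<close>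
  on the action.\<close>

lemma ident_Act: "ident 1 1 [cls z2sets_pres 1 (App Act [Var 0])] = Idn Sets 1"
  unfolding ident_def Sets_def Idn_theory_of
  using interp_cls[OF wf_z2sets wf_sets ident_axioms, of "[App Act [Var 0]]" 1 1] by simp

lemma invo_to_kei_hom: "invo_to_kei \<in> theory_hom Invo Kei"
  unfolding invo_to_kei_def Invo_def Kei_def
  using extend_hom[OF wf_invo wf_kei] invo_kei by simp

lemma sets_to_kei_hom: "sets_to_kei \<in> theory_hom Sets Kei"
  unfolding sets_to_kei_def Sets_def Kei_def by (rule extend_hom[OF wf_sets wf_kei sets_kei])

lemma Act_Hom: "[cls z2sets_pres 1 (App Act [Var 0])] \<in> Hom Z2Sets 1 1"
  unfolding Z2Sets_def using in_Hom[of "[App Act [Var 0]]" 1 z2sets_pres 1] by simp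

lemma kei_idem: "cls kei_pres 1 (Var 0 \<triangleright> Var 0) = cls kei_pres 1 (Var 0)"
  using eqv.Ax[of "Var 0 \<triangleright> Var 0" "Var 0" kei_pres "\<lambda>_. Var 0" 1]
  by (intro cls_eq) (simp add: kei_pres_def)

lemma invo_to_kei_can_Act:
  "invo_to_kei 1 1 (can 1 1 [cls z2sets_pres 1 (App Act [Var 0])]) = Idn Kei 1"
  unfolding can_Act invo_to_kei_def Kei_def Idn_theory_of
  using extend_cls[OF wf_invo wf_kei _ invo_kei(2,3), of "[Var 0 \<triangleright> Var 0]" 1 1] invo_kei(1) kei_idem
  by simp

lemma square_commutes: "theory_comp Z2Sets invo_to_kei can = theory_comp Z2Sets sets_to_kei ident"
proof (rule theory_hom_eqI[OF wf_z2sets lawvere_theory_theory_of[OF wf_kei]])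
  note Z = lawvere_theory_theory_of[OF wf_z2sets]
  show "theory_comp Z2Sets invo_to_kei can \<in> theory_hom (theory_of z2sets_pres) (theory_of kei_pres)"
    using theory_comp_hom[OF Z can_hom[unfolded Z2Sets_def] invo_to_kei_hom]
    by (simp add: Z2Sets_def Kei_def)
  show "theory_comp Z2Sets sets_to_kei ident \<in> theory_hom (theory_of z2sets_pres) (theory_of kei_pres)"
    using theory_comp_hom[OF Z ident_hom[unfolded Z2Sets_def] sets_to_kei_hom]
    by (simp add: Z2Sets_def Kei_def)
  fix f assume "f \<in> Ops z2sets_pres"
  then have f: "f = Act" "Ar z2sets_pres f = 1" by (auto simp: z2sets_pres_def)
  \<comment> \<open>On the action both composites give \<open>Idn Kei 1\<close>: one by idempotence
    in \<open>Kei\<close>, the other because \<open>sets_to_kei\<close> preserves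
    identities.\<close>
  show "theory_comp Z2Sets invo_to_kei can (Ar z2sets_pres f) 1
      [cls z2sets_pres (Ar z2sets_pres f) (App f (map Var [0..<Ar z2sets_pres f]))]
    = theory_comp Z2Sets sets_to_kei ident (Ar z2sets_pres f) 1
      [cls z2sets_pres (Ar z2sets_pres f) (App f (map Var [0..<Ar z2sets_pres f]))]"
    unfolding f(2) using f(1) invo_to_kei_can_Act ident_Act theory_hom_Idn[OF sets_to_kei_hom]
    by (simp add: theory_comp_apply[OF Act_Hom, simplified])
qed

text \<open>There are no operations on which \<phi> and \<psi> could differ. This is the uniqueness
  half of initiality; it makes the triangle over \<open>Sets\<close> commute in the pushout.\<close>

lemma Sets_initial:
  assumes "lawvere_theory T" "\<phi> \<in> theory_hom Sets T" "\<psi> \<in> theory_hom Sets T"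
  shows "\<phi> = \<psi>"
  by (rule theory_hom_eqI[OF wf_sets assms(1)])
     (use assms in \<open>simp_all add: Sets_def sets_pres_def\<close>)

text \<open>Supplies the hypothesis of \<open>hom_from_extension_exists\<close>: the cocone
  condition at the action says that \<open>g\<close> sends \<open>x \<triangleright> x\<close> and
  \<open>x\<close> to the same arrow.\<close>

lemma cocone_respects_kei:
  assumes f: "f \<in> theory_hom Sets T" and g: "g \<in> theory_hom Invo T"
    and eq: "theory_comp Z2Sets g can = theory_comp Z2Sets f ident"
    and lr: "(l, r) \<in> Eqs kei_pres"
  shows "\<exists>k. l \<in> trms invo_pres k \<and> r \<in> trms invo_pres k \<and>
    g k 1 [cls invo_pres k l] = g k 1 [cls invo_pres k r]"
proof -
  have "g 1 1 [cls invo_pres 1 (Var 0 \<triangleright> Var 0)] = f 1 1 (Idn Sets 1)"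
    using theory_comp_apply[OF Act_Hom] eq can_Act ident_Act by metis
  also have "\<dots> = g 1 1 (Idn Invo 1)"
    using theory_hom_Idn[OF f] theory_hom_Idn[OF g] by metis
  also have "Idn Invo 1 = [cls invo_pres 1 (Var 0)]"
    by (simp add: Invo_def Idn_theory_of)
  finally have idem: "g 1 1 [cls invo_pres 1 (Var 0 \<triangleright> Var 0)] = g 1 1 [cls invo_pres 1 (Var 0)]" .
  \<comment> \<open>The two inherited axioms hold in \<open>Invo\<close> already, so the classes
    agree before \<open>g\<close> is applied; they involve three and two variables.\<close>
  have distrib: "cls invo_pres 3 (Var 0 \<triangleright> (Var 1 \<triangleright> Var 2))
      = cls invo_pres 3 ((Var 0 \<triangleright> Var 1) \<triangleright> (Var 0 \<triangleright> Var 2))"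
    by (rule cls_eq[OF eqv_invo_distrib]) simp_all
  have cancel: "cls invo_pres 2 (Var 0 \<triangleright> (Var 0 \<triangleright> Var 1)) = cls invo_pres 2 (Var 1)"
    by (rule cls_eq[OF eqv_invo_cancel]) simp_all
  consider "(l, r) = (Var 0 \<triangleright> Var 0, Var 0)"
    | "(l, r) = (Var 0 \<triangleright> (Var 1 \<triangleright> Var 2), (Var 0 \<triangleright> Var 1) \<triangleright> (Var 0 \<triangleright> Var 2))"
    | "(l, r) = (Var 0 \<triangleright> (Var 0 \<triangleright> Var 1), Var 1)"
    using lr by (auto simp: kei_pres_def invo_pres_def)
  then show ?thesis
  proof cases
    case 1
    then show ?thesis using idem by (intro exI[of _ 1]) simp
  next
    case 2
    then show ?thesis using distrib by (intro exI[of _ 3]) simp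
  next
    case 3
    then show ?thesis using cancel by (intro exI[of _ 2]) simp
  qed
qed

theorem theorem6p6:
  shows "is_pushout TYPE('t) Z2Sets Sets Invo Kei can ident invo_to_kei sets_to_kei"
  unfolding is_pushout_def
proof (intro conjI allI impI)
  show "lawvere_theory Z2Sets" "lawvere_theory Invo" "lawvere_theory Kei"
    unfolding Z2Sets_def Invo_def Kei_def
    by (intro lawvere_theory_theory_of wf_z2sets wf_invo wf_kei)+
  show Sets: "lawvere_theory Sets"
    unfolding Sets_def by (rule lawvere_theory_theory_of[OF wf_sets])
  fix T :: "'t lawvere" and f g
  assume "lawvere_theory T \<and> f \<in> theory_hom Sets T \<and> g \<in> theory_hom Invo T \<and>
    theory_comp Z2Sets g can = theory_comp Z2Sets f ident"
  then have T: "lawvere_theory T" and f: "f \<in> theory_hom Sets T" and g: "g \<in> theory_hom Invo T"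
    and eq: "theory_comp Z2Sets g can = theory_comp Z2Sets f ident" by auto
  have lower: "theory_comp Sets h sets_to_kei = f" if "h \<in> theory_hom Kei T" for h
    by (rule Sets_initial[OF T theory_comp_hom[OF Sets sets_to_kei_hom that] f])
  obtain h where h: "h \<in> theory_hom Kei T" "theory_comp Invo h invo_to_kei = g"
    using hom_from_extension_exists[OF wf_invo wf_kei invo_kei T g[unfolded Invo_def]
        cocone_respects_kei[OF f g eq]]
    unfolding Kei_def Invo_def invo_to_kei_def by blast
  show "\<exists>!h. h \<in> theory_hom Kei T \<and>
      theory_comp Sets h sets_to_kei = f \<and> theory_comp Invo h invo_to_kei = g"
  proof (rule ex1I[of _ h])
    fix h' assume h': "h' \<in> theory_hom Kei T \<and>
      theory_comp Sets h' sets_to_kei = f \<and> theory_comp Invo h' invo_to_kei = g"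
    show "h' = h"
      by (rule hom_from_extension_unique[OF wf_invo wf_kei invo_kei])
         (use h h' in \<open>simp_all add: Kei_def Invo_def invo_to_kei_def\<close>)
  qed (use h lower in blast)
qed (rule can_hom ident_hom invo_to_kei_hom sets_to_kei_hom square_commutes)+

end
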